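(* Let $n\ge 1$, let $d$ be a positive even integer, let $K\subset\mathbb{R}^n$ be compact with nonempty interior (not necessarily convex), and consider the optimization problem $$\mathcal{P}:\qquad \rho=\inf_{g\in H[x]_d}\left\{\int_{\mathbb{R}^n}\exp(-g(x))\,dx\;:\; 1-g\in C_d(K)\right\}.$$ (a) $\mathcal{P}$ has a unique optimal solution $g^*\in P[x]_d$. (b) Let $g^*\in P[x]_d$ be the unique optimal solution of $\mathcal{P}$. If $g^*\in\mathrm{int}(P[x]_d)$, then there exists a finite Borel measure $\mu^*\in\mathcal{M}(K)_+$ such that $$\int_{\mathbb{R}^n}x^\alpha\exp(-g^*(x))\,dx=\int_K x^\alpha\,d\mu^*\qquad\text{for all }\alpha\in\mathbb{N}^n\text{ with }|\alpha|=d,$$ $$\int_K(1-g^* )\,d\mu^*=0,\qquad \mu^*(K)=\frac{n}{d}\int_{\mathbb{R}^n}\exp(-g^*(x))\,dx.$$ In particular, $\mu^*$ is supported on the set $V:=\{x\in K: g^*(x)=1\}$, and in fact $\mu^*$ can be substituted (in the displayed conditions) with another measure $\nu^*\in\mathcal{M}(K)_+$ supported on at most $\binom{n+d-1}{d}$ points of $V$. (c) Conversely, if $g^*\in\mathbb{R}[x]_d$ is homogeneous of degree $d$ with $1-g^*\in C_d(K)$, and there exist points $(x_i,\lambda_i)\in K\times\mathbb{R}$ with $\lambda_i>0$, $i=1,\ldots,s$, such that $g^*(x_i)=1$ for all $i=1,\ldots,s$ and $$\int_{\mathbb{R}^n}x^\alpha\exp(-g^*(x))\,dx=\sum_{i=1}^s\lambda_i\,x_i^\alpha\qquad\text{for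 all }\alpha\in\mathbb{N}^n\text{ with }|\alpha|=d,$$ then $g^*$ is the unique optimal solution of $\mathcal{P}$.
   Context: $\mathbb{R}[x]_d$ is the vector space of real polynomials in $x=(x_1,\ldots,x_n)$ of degree at most $d$. For $\alpha\in\mathbb{N}^n$, $|\alpha|=\sum_i\alpha_i$ and $x^\alpha=x_1^{\alpha_1}\cdots x_n^{\alpha_n}$. $H[x]_d$ is the vector space of homogeneous polynomials of degree $d$ (including $0$), i.e. $f(\lambda x)=\lambda^d f(x)$ for all $x\in\mathbb{R}^n$, $\lambda\in\mathbb{R}$. $P[x]_d\subset H[x]_d$ is the set of those $g\in H[x]_d$ whose sublevel set $\{x\in\mathbb{R}^n: g(x)\le 1\}$ has finite Lebesgue volume; $\mathrm{int}(P[x]_d)$ is its interior in the finite-dimensional space $H[x]_d$. $C_d(K)$ is the convex cone of polynomials of degree at most $d$ that are nonnegative on $K$. $\mathcal{M}(K)_+$ is the convex cone of finite (positive) Borel measures with support contained in $K$. The objective of $\mathcal{P}$ is allowed to take the value $+\infty$; an optimal solution is a feasible $g$ attaining the infimum. *)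

theory Defs
  imports "HOL-Analysis.Analysis"
begin

text \<open>
  Real polynomials in \<open>n = CARD('n)\<close> variables are represented by the functions
  \<open>real ^ 'n \<Rightarrow> real\<close> they induce; this loses nothing because the ground field is infinite.
  A multi-index is a function \<open>'n \<Rightarrow> nat\<close>.
\<close>

definition mdeg :: "('n::finite \<Rightarrow> nat) \<Rightarrow> nat" where
  "mdeg \<alpha> = (\<Sum>i\<in>UNIV. \<alpha> i)"

definition monomial :: "('n::finite \<Rightarrow> nat) \<Rightarrow> real ^ 'n \<Rightarrow> real" where
  "monomial \<alpha> x = (\<Prod>i\<in>UNIV. (x $ i) ^ \<alpha> i)"

text \<open>The sum below ranges over a finite set, so it is not the junk value \<open>0\<close>.\<close>

lemma finite_mdeg_le: "finite {\<alpha> :: 'n::finite \<Rightarrow> nat. mdeg \<alpha> \<le> d}"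
proof (rule finite_subset)
  have "\<alpha> i \<le> d" if "mdeg \<alpha> \<le> d" for \<alpha> :: "'n \<Rightarrow> nat" and i
    using that member_le_sum[of i UNIV \<alpha>] unfolding mdeg_def by simp
  then show "{\<alpha> :: 'n \<Rightarrow> nat. mdeg \<alpha> \<le> d} \<subseteq> Pi\<^sub>E UNIV (\<lambda>_. {..d})"
    by auto
  show "finite (Pi\<^sub>E (UNIV :: 'n set) (\<lambda>_. {..d}))"
    by (intro finite_PiE) auto
qed

definition polys :: "nat \<Rightarrow> (real ^ 'n \<Rightarrow> real) set" where
  "polys d = {f. \<exists>c. f = (\<lambda>x. \<Sum>\<alpha> | mdeg \<alpha> \<le> d. c \<alpha> * monomial \<alpha> x)}"

definition homog :: "nat \<Rightarrow> (real ^ 'n \<Rightarrow> real) set" where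
  "homog d = {f \<in> polys d. \<forall>x t. f (t *\<^sub>R x) = t ^ d * f x}"

definition finite_vol_homog :: "nat \<Rightarrow> (real ^ 'n \<Rightarrow> real) set" where
  "finite_vol_homog d = {g \<in> homog d. emeasure lborel {x. g x \<le> 1} < \<infinity>}"

text \<open>
  The ambient topology of the next definition is that of pointwise convergence (the library's
  topology on function types), restricted to \<^term>\<open>homog d\<close>. It is a Hausdorff vector space
  topology on a finite-dimensional space, hence the usual one.
\<close>

definition int_finite_vol_homog :: "nat \<Rightarrow> (real ^ 'n \<Rightarrow> real) set" where
  "int_finite_vol_homog d = (top_of_set (homog d)) interior_of (finite_vol_homog d)"

definition nonneg_polys :: "nat \<Rightarrow> (real ^ 'n) set \<Rightarrow> (real ^ 'n \<Rightarrow> real) set" where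
  "nonneg_polys d K = {f \<in> polys d. \<forall>x\<in>K. 0 \<le> f x}"

definition measure_support :: "'a::topological_space measure \<Rightarrow> 'a set" where
  "measure_support \<mu> = {x. \<forall>U. open U \<longrightarrow> x \<in> U \<longrightarrow> emeasure \<mu> U > 0}"

definition finite_borel_measures_on :: "'a::topological_space set \<Rightarrow> 'a measure set" where
  "finite_borel_measures_on K =
     {\<mu>. sets \<mu> = sets borel \<and> finite_measure \<mu> \<and> measure_support \<mu> \<subseteq> K}"

definition feasible :: "nat \<Rightarrow> (real ^ 'n) set \<Rightarrow> (real ^ 'n \<Rightarrow> real) set" where
  "feasible d K = {g \<in> homog d. (\<lambda>x. 1 - g x) \<in> nonneg_polys d K}"

definition objective :: "(real ^ 'n \<Rightarrow> real) \<Rightarrow> ennreal" where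
  "objective g = (\<integral>\<^sup>+ x. ennreal (exp (- g x)) \<partial>lborel)"

definition optimal_solution :: "nat \<Rightarrow> (real ^ 'n) set \<Rightarrow> (real ^ 'n \<Rightarrow> real) \<Rightarrow> bool" where
  "optimal_solution d K g \<longleftrightarrow>
     g \<in> feasible d K \<and> objective g = (INF h \<in> feasible d K. objective h)"

definition unique_optimal_solution ::
  "nat \<Rightarrow> (real ^ 'n) set \<Rightarrow> (real ^ 'n \<Rightarrow> real) \<Rightarrow> bool" where
  "unique_optimal_solution d K g \<longleftrightarrow>
     optimal_solution d K g \<and> (\<forall>h. optimal_solution d K h \<longrightarrow> h = g)"

text \<open>
  \<^const>\<open>has_bochner_integral\<close> asserts that the moment on the left-hand side exists, as well as
  its value; a plain equation would also hold for divergent integrals, read as \<open>0\<close>.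
\<close>

definition optimality_conditions ::
  "nat \<Rightarrow> (real ^ 'n) set \<Rightarrow> (real ^ 'n \<Rightarrow> real) \<Rightarrow> (real ^ 'n) measure \<Rightarrow> bool" where
  "optimality_conditions d K g \<mu> \<longleftrightarrow>
     (\<forall>\<alpha>. mdeg \<alpha> = d \<longrightarrow>
        has_bochner_integral lborel (\<lambda>x. monomial \<alpha> x * exp (- g x))
          (LINT x:K|\<mu>. monomial \<alpha> x)) \<and>
     (LINT x:K|\<mu>. 1 - g x) = 0 \<and>
     integrable lborel (\<lambda>x. exp (- g x)) \<and>
     measure \<mu> K = real CARD('n) / real d * (LINT x|lborel. exp (- g x))"

end

theory Submission
  imports Defs "HOL-Real_Asymp.Real_Asymp"
begin

text \<open>
  The problem is convex: the feasible set is convex, and \<open>g \<mapsto> \<integral> exp (- g)\<close> is strictly convex where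
  it is finite. All three parts follow from this, from homogeneity, and from compactness in the
  finite-dimensional space of forms.

  \<^emph>\<open>Existence and uniqueness.\<close> A form whose objective is finite has a sublevel set of finite
  volume, and such a form is nonnegative, since a negative value would spread by homogeneity over a
  cone of infinite volume. A feasible form of finite objective therefore takes values between \<open>0\<close>
  and \<open>1\<close> on \<open>K\<close>, and as \<open>K\<close> contains a ball, this bounds its coefficients
  (\<open>form_coeffs_bounded\<close>). A minimising sequence thus has a subsequence converging to a feasible form,
  which is optimal by Fatou's lemma (\<open>optimal_solution_exists\<close>). Two optimal forms coincide because
  their midpoint would otherwise be strictly better (\<open>optimal_solution_unique\<close>).

  \<^emph>\<open>Necessity.\<close> If \<open>g\<close> lies in the interior of the cone of forms with finite volume, then some
  \<open>g - \<epsilon> * (\<Sum>\<^sub>i x\<^sub>i ^ d)\<close> with \<open>\<epsilon> > 0\<close> still belongs to this cone, so it is nonnegative and \<open>g\<close> is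
  positive definite with a margin. The objective is then differentiable at \<open>g\<close> in every direction
  \<open>h\<close>, with derivative \<open>- \<integral> h * exp (- g)\<close> (\<open>derivative_integral_exp_neg\<close>). Consider the vector of
  moments of order \<open>d\<close> of \<open>exp (- g)\<close>, and the cone generated by the vectors of monomials
  at the points of the contact set \<open>{x \<in> K. g x = 1}\<close>. If the former were not in the latter,
  a separating functional would be a form \<open>h\<close> that is negative on the contact set, hence a
  feasible direction, but has \<open>\<integral> h * exp (- g) > 0\<close>, hence decreases the objective. So the moment
  vector is a nonnegative combination of evaluations at contact points, and by Caratheodory's theorem no
  more of them are needed than there are monomials of degree \<open>d\<close> (\<open>compact_cone_alternative\<close>). The
  discrete measure with these atoms and weights serves both as \<open>\<mu>\<close> and as \<open>\<nu>\<close>. Its mass comes from Euler's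
  identity \<open>\<integral> g * exp (- g) = n / d * \<integral> exp (- g)\<close> (\<open>integral_form_exp_neg\<close>).

  \<^emph>\<open>Sufficiency.\<close> The tangent inequality for \<open>exp\<close> bounds the objective at a feasible \<open>h\<close> from
  below by the objective at \<open>g\<close> plus \<open>\<integral> (g - h) * exp (- g)\<close>, which the representation of the
  moments identifies with the sum of the terms \<open>\<lambda>\<^sub>i * (1 - h x\<^sub>i) \<ge> 0\<close>.
\<close>

section \<open>Homogeneous forms and their coefficients\<close>

definition form :: "nat \<Rightarrow> (('n::finite \<Rightarrow> nat) \<Rightarrow> real) \<Rightarrow> real ^ 'n \<Rightarrow> real" where
  "form d c x = (\<Sum>\<alpha> | mdeg \<alpha> = d. c \<alpha> * monomial \<alpha> x)"

lemma finite_mdeg_eq: "finite {\<alpha> :: 'n::finite \<Rightarrow> nat. mdeg \<alpha> = d}"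
  by (rule finite_subset[OF _ finite_mdeg_le[of d]]) auto

lemma monomial_scaleR: "monomial \<alpha> (t *\<^sub>R x) = t ^ mdeg \<alpha> * monomial \<alpha> x"
  by (simp add: monomial_def mdeg_def power_mult_distrib prod.distrib power_sum)

lemma form_scaleR: "form d c (t *\<^sub>R x) = t ^ d * form d c x"
  by (simp add: form_def monomial_scaleR sum_distrib_left mult_ac)

lemma form_in_polys: "form d c \<in> polys d"
proof -
  have "form d c x = (\<Sum>\<alpha> | mdeg \<alpha> \<le> d. (if mdeg \<alpha> = d then c \<alpha> else 0) * monomial \<alpha> x)" for x
    unfolding form_def
    by (rule sum.mono_neutral_cong_left) (auto intro: finite_mdeg_le)
  then show ?thesis
    unfolding polys_def by (auto simp: fun_eq_iff intro!: exI[of _ "\<lambda>\<alpha>. if mdeg \<alpha> = d then c \<alpha> else 0"])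
qed

text \<open>
  A polynomial that scales like \<open>t ^ d\<close> equals its component of degree \<open>d\<close>: compare the
  coefficients of the two polynomials in \<open>t\<close> obtained along a ray.
\<close>

lemma homog_eq_range_form: "homog d = range (form d)"
proof (intro equalityI subsetI)
  fix f assume f: "f \<in> homog d"
  then obtain c where c: "f = (\<lambda>x. \<Sum>\<alpha> | mdeg \<alpha> \<le> d. c \<alpha> * monomial \<alpha> x)"
    by (auto simp: homog_def polys_def)
  have "f x = form d c x" for x
  proof -
    have "(\<Sum>k\<le>d. form k c x * t ^ k) = (\<Sum>k\<le>d. (if k = d then f x else 0) * t ^ k)" for t
    proof -
      have "(\<Sum>k\<le>d. form k c x * t ^ k) = (\<Sum>k\<le>d. form k c (t *\<^sub>R x))"
        by (simp add: form_scaleR mult_ac)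
      also have "\<dots> = (\<Sum>k\<le>d. \<Sum>\<alpha> | \<alpha> \<in> {\<alpha>. mdeg \<alpha> \<le> d} \<and> mdeg \<alpha> = k. c \<alpha> * monomial \<alpha> (t *\<^sub>R x))"
        unfolding form_def by (intro sum.cong) auto
      also have "\<dots> = f (t *\<^sub>R x)"
        unfolding c by (rule sum.group) (auto intro: finite_mdeg_le)
      also have "\<dots> = t ^ d * f x"
        using f by (simp add: homog_def)
      also have "\<dots> = (\<Sum>k\<le>d. if k = d then t ^ d * f x else 0)"
        by simp
      also have "\<dots> = (\<Sum>k\<le>d. (if k = d then f x else 0) * t ^ k)"
        by (intro sum.cong) auto
      finally show ?thesis .
    qed
    then have "\<forall>k\<le>d. form k c x = (if k = d then f x else 0)"
      using polyfun_eq_coeffs[of "\<lambda>k. form k c x" d "\<lambda>k. if k = d then f x else 0"] by blast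
    then show ?thesis by simp
  qed
  then show "f \<in> range (form d)" by auto
next
  fix f assume "f \<in> range (form d :: _ \<Rightarrow> real ^ 'a \<Rightarrow> real)"
  then show "f \<in> homog d"
    by (auto simp: homog_def form_in_polys form_scaleR)
qed

lemma form_add_scale: "form d (\<lambda>\<alpha>. a * c \<alpha> + b * c' \<alpha>) x = a * form d c x + b * form d c' x"
  by (simp add: form_def sum_distrib_left sum.distrib algebra_simps)

lemma homog_lincomb:
  assumes "f \<in> homog d" "g \<in> homog d"
  shows "(\<lambda>x. a * f x + b * g x) \<in> homog d"
proof -
  obtain c c' where "f = form d c" "g = form d c'"
    using assms by (auto simp: homog_eq_range_form)
  then have "(\<lambda>x. a * f x + b * g x) = form d (\<lambda>\<alpha>. a * c \<alpha> + b * c' \<alpha>)"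
    by (auto simp: form_add_scale)
  then show ?thesis by (auto simp: homog_eq_range_form)
qed

lemma homog_scaleR: "f \<in> homog d \<Longrightarrow> f (t *\<^sub>R x) = t ^ d * f x"
  by (simp add: homog_def)

lemma homog_in_polys: "f \<in> homog d \<Longrightarrow> f \<in> polys d"
  by (simp add: homog_def)

lemma one_minus_in_polys:
  assumes "f \<in> polys d" shows "(\<lambda>x. 1 - f x) \<in> polys d"
proof -
  obtain c where c: "f = (\<lambda>x. \<Sum>\<alpha> | mdeg \<alpha> \<le> d. c \<alpha> * monomial \<alpha> x)"
    using assms by (auto simp: polys_def)
  have "(\<Sum>\<alpha> | mdeg \<alpha> \<le> d. ((if \<alpha> = (\<lambda>_. 0) then 1 else 0) - c \<alpha>) * monomial \<alpha> x) = 1 - f x" for x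
  proof -
    have "(\<Sum>\<alpha> | mdeg \<alpha> \<le> d. (if \<alpha> = (\<lambda>_. 0) then 1 else 0) * monomial \<alpha> x)
        = (\<Sum>\<alpha> | mdeg \<alpha> \<le> d. if \<alpha> = (\<lambda>_. 0) then monomial \<alpha> x else 0)"
      by (rule sum.cong) auto
    also have "\<dots> = 1"
      using finite_mdeg_le[where 'n = 'a] by (subst sum.delta) (auto simp: mdeg_def monomial_def)
    finally show ?thesis
      by (simp add: left_diff_distrib sum_subtractf c)
  qed
  then show ?thesis unfolding polys_def by (auto simp: fun_eq_iff intro!: exI[of _ "\<lambda>\<alpha>. (if \<alpha> = (\<lambda>_. 0) then 1 else 0) - c \<alpha>"])
qed

lemma feasible_iff: "g \<in> feasible d K \<longleftrightarrow> g \<in> homog d \<and> (\<forall>x\<in>K. g x \<le> 1)"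
  using one_minus_in_polys[OF homog_in_polys] by (auto simp: feasible_def nonneg_polys_def)

lemma continuous_on_monomial [continuous_intros]: "continuous_on S (monomial \<alpha>)"
  unfolding monomial_def by (intro continuous_intros)

lemma continuous_on_homog: "f \<in> homog d \<Longrightarrow> continuous_on S f"
  by (auto simp: homog_eq_range_form form_def[abs_def] intro!: continuous_intros)

lemma borel_measurable_monomial [measurable]: "monomial \<alpha> \<in> borel_measurable borel"
  by (intro borel_measurable_continuous_onI continuous_intros)

lemma borel_measurable_homog: "f \<in> homog d \<Longrightarrow> f \<in> borel_measurable borel"
  by (intro borel_measurable_continuous_onI continuous_on_homog)

text \<open>
  On each line through the centre of the ball, \<open>f\<close> is a univariate polynomial with infinitely many
  zeros.
\<close>

lemma polynomial_vanishing_on_ball: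
  fixes f :: "'a::euclidean_space \<Rightarrow> real"
  assumes "real_polynomial_function f" "r > 0" "\<And>x. x \<in> ball x0 r \<Longrightarrow> f x = 0"
  shows "f y = 0"
proof -
  let ?l = "\<lambda>t::real. x0 + t *\<^sub>R (y - x0)"
  have "real_polynomial_function (f \<circ> ?l)"
  proof (rule real_polynomial_function_compose[OF _ assms(1)])
    show "polynomial_function ?l"
      by (intro polynomial_function_add polynomial_function_const polynomial_function_bounded_linear bounded_linear_intros)
  qed
  then obtain a n where an: "f \<circ> ?l = (\<lambda>t. \<Sum>i\<le>n. a i * t ^ i)"
    unfolding real_polynomial_function_iff_sum by blast
  \<comment> \<open>The summand \<open>1\<close> covers the case \<open>y = x0\<close>.\<close>
  define e where "e = r / (norm (y - x0) + 1)"
  have "{0<..<e} \<subseteq> {t. (\<Sum>i\<le>n. a i * t ^ i) = 0}"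
  proof
    fix t assume t: "t \<in> {0<..<e}"
    have "t * norm (y - x0) \<le> t * (norm (y - x0) + 1)"
      using t by (intro mult_left_mono) auto
    also have "\<dots> < e * (norm (y - x0) + 1)"
      using t by (intro mult_strict_right_mono) (auto intro: add_nonneg_pos)
    also have "\<dots> = r" by (simp add: e_def) (smt (verit) norm_ge_zero)
    finally have "?l t \<in> ball x0 r" using t by (simp add: dist_norm)
    then show "t \<in> {t. (\<Sum>i\<le>n. a i * t ^ i) = 0}"
      using assms(3) fun_cong[OF an, of t] by simp
  qed
  moreover have "infinite {0<..<e}"
    using \<open>r > 0\<close> by (simp add: e_def infinite_Ioo add_nonneg_pos)
  ultimately have "infinite {t. (\<Sum>i\<le>n. a i * t ^ i) = 0}"
    using finite_subset by blast
  then have "\<forall>i\<le>n. a i = 0"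
    using polyfun_finite_roots[of a n] by blast
  then show ?thesis
    using fun_cong[OF an, of 1] by simp
qed

lemma real_polynomial_function_homog:
  "f \<in> homog d \<Longrightarrow> real_polynomial_function f"
proof -
  have "real_polynomial_function (monomial \<alpha>)" for \<alpha> :: "'a \<Rightarrow> nat"
    unfolding monomial_def
    by (intro real_polynomial_function_prod real_polynomial_function_power
        real_polynomial_function.intros(1) bounded_linear_vec_nth) auto
  then show "f \<in> homog d \<Longrightarrow> real_polynomial_function f"
    by (auto simp: homog_eq_range_form form_def[abs_def]
        intro!: real_polynomial_function_sum real_polynomial_function.intros(2,4)
          finite_mdeg_eq)
qed

text \<open>
  If two multi-indices of \<open>T\<close> differ at \<open>i\<close>, scaling the coordinate \<open>i\<close> by \<open>t\<close> turns the relation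
  into a polynomial identity in \<open>t\<close>; each of its coefficients is a relation with fewer monomials.
\<close>

lemma monomials_linearly_independent:
  assumes "finite T" "\<And>x::real^'n. (\<Sum>\<alpha>\<in>T. c \<alpha> * monomial \<alpha> x) = 0" "\<alpha> \<in> T"
  shows "c \<alpha> = 0"
  using assms
proof (induction T rule: finite_psubset_induct)
  case (psubset T)
  show ?case
  proof (cases "T = {\<alpha>}")
    case True
    then show ?thesis using psubset.prems(1)[of "\<chi> i. 1"] by (simp add: monomial_def)
  next
    case False
    then obtain \<beta> where \<beta>: "\<beta> \<in> T" "\<beta> \<noteq> \<alpha>" using psubset.prems(2) by blast
    then obtain i where i: "\<beta> i \<noteq> \<alpha> i" by auto
    define m where "m = Max ((\<lambda>\<gamma>. \<gamma> i) ` T)"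
    have m: "\<gamma> i \<le> m" if "\<gamma> \<in> T" for \<gamma>
      unfolding m_def using that \<open>finite T\<close> by (intro Max_ge) auto
    define S where "S k = {\<gamma>\<in>T. \<gamma> i = k}" for k
    have "(\<Sum>\<gamma>\<in>S (\<alpha> i). c \<gamma> * monomial \<gamma> x) = 0" for x :: "real^'n"
    proof -
      have "(\<Sum>k\<le>m. (\<Sum>\<gamma>\<in>S k. c \<gamma> * monomial \<gamma> x) * t ^ k) = 0" for t
      proof -
        define x' :: "real^'n" where "x' = (\<chi> j. if j = i then t * x $ j else x $ j)"
        have mono: "monomial \<gamma> x' = t ^ \<gamma> i * monomial \<gamma> x" for \<gamma>
        proof -
          have "monomial \<gamma> x' = (\<Prod>j\<in>UNIV. (if j = i then t ^ \<gamma> j else 1) * (x $ j) ^ \<gamma> j)"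
            unfolding monomial_def x'_def by (intro prod.cong) (auto simp: power_mult_distrib)
          also have "\<dots> = t ^ \<gamma> i * monomial \<gamma> x"
            by (simp add: prod.distrib monomial_def)
          finally show ?thesis .
        qed
        have "(\<Sum>k\<le>m. (\<Sum>\<gamma>\<in>S k. c \<gamma> * monomial \<gamma> x) * t ^ k)
            = (\<Sum>k\<le>m. \<Sum>\<gamma>\<in>S k. c \<gamma> * monomial \<gamma> x')"
          unfolding sum_distrib_right by (intro sum.cong refl) (simp add: mono S_def mult_ac)
        also have "\<dots> = (\<Sum>\<gamma>\<in>T. c \<gamma> * monomial \<gamma> x')"
          unfolding S_def by (rule sum.group) (use \<open>finite T\<close> m in auto)
        finally show ?thesis using psubset.prems(1) by simp
      qed
      then show ?thesis
        using polyfun_eq_0[of "\<lambda>k. \<Sum>\<gamma>\<in>S k. c \<gamma> * monomial \<gamma> x" m] m[OF psubset.prems(2)] by blast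
    qed
    moreover have "S (\<alpha> i) \<subset> T" "\<alpha> \<in> S (\<alpha> i)"
      using \<beta> i psubset.prems(2) by (auto simp: S_def)
    ultimately show ?thesis using psubset.IH by blast
  qed
qed

text \<open>
  Listing the values of a multi-index along an enumeration of the variables turns it into a weak
  composition of \<open>d\<close>.
\<close>

lemma card_mdeg_eq: "card {\<alpha> :: 'n::finite \<Rightarrow> nat. mdeg \<alpha> = d} = (CARD('n) + d - 1) choose d"
proof -
  obtain js :: "'n list" where js: "set js = UNIV" "distinct js"
    using finite_distinct_list[OF finite] by blast
  have len: "length js = CARD('n)" using js distinct_card by metis
  have "bij_betw (\<lambda>\<alpha>. map \<alpha> js) {\<alpha>. mdeg \<alpha> = d} {l. size l = CARD('n) \<and> sum_list l = d}"
  proof (rule bij_betwI')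
    fix \<alpha> \<beta> :: "'n \<Rightarrow> nat"
    show "map \<alpha> js = map \<beta> js \<longleftrightarrow> \<alpha> = \<beta>" using js by auto
  next
    fix \<alpha> :: "'n \<Rightarrow> nat" assume "\<alpha> \<in> {\<alpha>. mdeg \<alpha> = d}"
    then show "map \<alpha> js \<in> {l. size l = CARD('n) \<and> sum_list l = d}"
      using js len by (simp add: mdeg_def sum_list_distinct_conv_sum_set)
  next
    fix l assume l: "l \<in> {l :: nat list. size l = CARD('n) \<and> sum_list l = d}"
    define \<alpha> where "\<alpha> i = the (map_of (zip js l) i)" for i
    have "map \<alpha> js = l"
      using l len js by (intro nth_equalityI) (auto simp: \<alpha>_def map_of_zip_nth)
    moreover from this have "mdeg \<alpha> = d"
      using l js by (metis (mono_tags, lifting) mdeg_def mem_Collect_eq sum_list_distinct_conv_sum_set)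
    ultimately show "\<exists>\<alpha>\<in>{\<alpha>. mdeg \<alpha> = d}. l = map \<alpha> js" by auto
  qed
  then show ?thesis
    by (simp add: bij_betw_same_card card_length_sum_list add.commute)
qed

section \<open>Compactness of coefficient vectors\<close>

lemma compact_coordinates_convergent_subsequence:
  fixes u :: "nat \<Rightarrow> 'a \<Rightarrow> 'b::metric_space"
  assumes "finite A" "\<And>a. a \<in> A \<Longrightarrow> compact (S a)" "\<And>k a. a \<in> A \<Longrightarrow> u k a \<in> S a"
  shows "\<exists>r l. strict_mono (r :: nat \<Rightarrow> nat) \<and> (\<forall>a\<in>A. l a \<in> S a \<and> (\<lambda>k. u (r k) a) \<longlonglongrightarrow> l a)"
  using assms
proof (induction A rule: finite_induct)
  case empty
  then show ?case by (auto intro!: exI[of _ id] strict_mono_id)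
next
  case (insert a A)
  then obtain r l where r: "strict_mono r" "\<And>b. b \<in> A \<Longrightarrow> l b \<in> S b \<and> (\<lambda>k. u (r k) b) \<longlonglongrightarrow> l b"
    by auto blast
  have "\<forall>k. u (r k) a \<in> S a" "compact (S a)" using insert.prems by auto
  then obtain s m where s: "m \<in> S a" "strict_mono s" "((\<lambda>k. u (r k) a) \<circ> s) \<longlonglongrightarrow> m"
    using seq_compactE[of "S a" "\<lambda>k. u (r k) a"] compact_imp_seq_compact by metis
  have "l' b \<in> S b \<and> (\<lambda>k. u ((r \<circ> s) k) b) \<longlonglongrightarrow> l' b"
    if "l' = l(a := m)" "b \<in> insert a A" for b l'
    using that s LIMSEQ_subseq_LIMSEQ[OF conjunct2[OF r(2)] s(2)] r(2)
    by (cases "b = a") (auto simp: o_def)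
  then show ?case
    using strict_mono_o[OF r(1) s(2)] by blast
qed

text \<open>
  All norms on a finite-dimensional space are equivalent: otherwise normalised coefficient
  vectors would converge to a nonzero form vanishing on the ball.
\<close>

lemma form_coeffs_bounded:
  fixes x0 :: "real ^ 'n"
  assumes "r > 0"
  shows "\<exists>C. \<forall>c. (\<forall>x\<in>ball x0 r. \<bar>form d c x\<bar> \<le> 1) \<longrightarrow> (\<forall>\<alpha>. mdeg \<alpha> = d \<longrightarrow> \<bar>c \<alpha>\<bar> \<le> C)"
proof (rule ccontr)
  assume neg: "\<not> ?thesis"
  let ?A = "{\<alpha> :: 'n \<Rightarrow> nat. mdeg \<alpha> = d}"
  have "\<exists>c. (\<forall>x\<in>ball x0 r. \<bar>form d c x\<bar> \<le> 1) \<and> (\<exists>\<alpha>. mdeg \<alpha> = d \<and> \<bar>c \<alpha>\<bar> > real (Suc k))" for k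
    using neg by (meson not_le)
  then obtain c where c: "\<And>k x. x \<in> ball x0 r \<Longrightarrow> \<bar>form d (c k) x\<bar> \<le> 1"
      "\<And>k. \<exists>\<alpha>. mdeg \<alpha> = d \<and> \<bar>c k \<alpha>\<bar> > real (Suc k)"
    by metis
  define s where "s k = (\<Sum>\<alpha>\<in>?A. \<bar>c k \<alpha>\<bar>)" for k
  have s: "s k > real (Suc k)" for k
  proof -
    obtain \<alpha> where \<alpha>: "\<alpha> \<in> ?A" "\<bar>c k \<alpha>\<bar> > real (Suc k)" using c(2) by auto
    then show ?thesis
      unfolding s_def using member_le_sum[of \<alpha> ?A "\<lambda>\<alpha>. \<bar>c k \<alpha>\<bar>"] finite_mdeg_eq[where 'n='n] by force
  qed
  have spos: "s k > 0" for k using s[of k] by linarith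
  define b where "b k \<alpha> = c k \<alpha> / s k" for k \<alpha>
  have "b k \<alpha> \<in> {-1..1}" if "\<alpha> \<in> ?A" for k \<alpha>
    using member_le_sum[of \<alpha> ?A "\<lambda>\<alpha>. \<bar>c k \<alpha>\<bar>"] that finite_mdeg_eq[where 'n='n] spos[of k]
    by (auto simp: b_def s_def[symmetric] field_simps abs_le_iff)
  then obtain q l where q: "strict_mono q" and l: "\<And>\<alpha>. \<alpha> \<in> ?A \<Longrightarrow> (\<lambda>k. b (q k) \<alpha>) \<longlonglongrightarrow> l \<alpha>"
    using compact_coordinates_convergent_subsequence[of ?A "\<lambda>_. {-1..1::real}" b] finite_mdeg_eq[where 'n='n]
    by (metis compact_Icc)
  have "(\<lambda>k. \<Sum>\<alpha>\<in>?A. \<bar>b (q k) \<alpha>\<bar>) \<longlonglongrightarrow> (\<Sum>\<alpha>\<in>?A. \<bar>l \<alpha>\<bar>)"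
    by (intro tendsto_sum tendsto_rabs l)
  moreover have "(\<Sum>\<alpha>\<in>?A. \<bar>b k \<alpha>\<bar>) = 1" for k
    using spos[of k] by (simp add: b_def sum_divide_distrib[symmetric]) (simp add: s_def)
  ultimately have one: "(\<Sum>\<alpha>\<in>?A. \<bar>l \<alpha>\<bar>) = 1"
    by (simp add: LIMSEQ_const_iff)
  have "form d l x = 0" if x: "x \<in> ball x0 r" for x
  proof -
    have 1: "(\<lambda>k. form d (b (q k)) x) \<longlonglongrightarrow> form d l x"
      unfolding form_def by (intro tendsto_sum tendsto_mult tendsto_const l)
    have "\<bar>form d (b k) x\<bar> \<le> 1 / real (Suc k)" for k
    proof -
      have "form d (b k) x = form d (c k) x / s k"
        by (simp add: form_def b_def sum_divide_distrib)
      then have "\<bar>form d (b k) x\<bar> = \<bar>form d (c k) x\<bar> / s k"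
        using spos[of k] by simp
      also have "\<dots> \<le> 1 / real (Suc k)"
        using c(1)[OF x, of k] s[of k] by (intro frac_le) auto
      finally show ?thesis .
    qed
    then have "(\<lambda>k. form d (b k) x) \<longlonglongrightarrow> 0"
      by (intro Lim_null_comparison[OF _ LIMSEQ_Suc[OF lim_1_over_n]]) auto
    from LIMSEQ_subseq_LIMSEQ[OF this q] have "(\<lambda>k. form d (b (q k)) x) \<longlonglongrightarrow> 0"
      by (simp add: o_def)
    with 1 show ?thesis using LIMSEQ_unique by blast
  qed
  moreover have "form d l \<in> homog d" by (simp add: homog_eq_range_form)
  ultimately have "form d l x = 0" for x
    using polynomial_vanishing_on_ball[OF real_polynomial_function_homog \<open>r > 0\<close>] by blast
  then have "l \<alpha> = 0" if "\<alpha> \<in> ?A" for \<alpha>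
    using monomials_linearly_independent[of ?A l \<alpha>] that finite_mdeg_eq[where 'n='n] by (simp add: form_def)
  with one show False by simp
qed

section \<open>Separation from the cone generated by a compact family\<close>

text \<open>
  Elimination: an equation with a nonzero coefficient expresses one unknown by the others, and
  substituting it leaves a system with one equation and one unknown less.
\<close>

lemma homogeneous_system_nontrivial_solution:
  fixes m :: "'i \<Rightarrow> 'a \<Rightarrow> real"
  assumes "finite A" "finite I" "card A < card I"
  shows "\<exists>c. (\<exists>i\<in>I. c i \<noteq> 0) \<and> (\<forall>a\<in>A. (\<Sum>i\<in>I. c i * m i a) = 0)"
  using assms
proof (induction A arbitrary: I m rule: finite_induct)
  case empty
  then show ?case by (intro exI[of _ "\<lambda>_. 1"]) (auto simp: card_gt_0_iff)
next
  case (insert a A)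
  show ?case
  proof (cases "\<forall>i\<in>I. m i a = 0")
    case True
    then show ?thesis using insert.IH[of I m] insert.prems insert.hyps by auto
  next
    case False
    then obtain j where j: "j \<in> I" "m j a \<noteq> 0" by blast
    let ?I = "I - {j}"
    have "card A < card ?I" "finite ?I"
      using insert.prems insert.hyps j by auto
    then obtain c where c: "\<exists>i\<in>?I. c i \<noteq> 0"
        "\<And>b. b \<in> A \<Longrightarrow> (\<Sum>i\<in>?I. c i * (m i b - m i a / m j a * m j b)) = 0"
      using insert.IH[of ?I "\<lambda>i b. m i b - m i a / m j a * m j b"] by blast
    define t where "t = - (\<Sum>i\<in>?I. c i * m i a) / m j a"
    have sum_upd: "(\<Sum>i\<in>I. (c(j := t)) i * m i b) = t * m j b + (\<Sum>i\<in>?I. c i * m i b)" for b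
    proof -
      have "(\<Sum>i\<in>I. (c(j := t)) i * m i b) = t * m j b + (\<Sum>i\<in>?I. (c(j := t)) i * m i b)"
        using j insert.prems by (subst sum.remove[of I j]) auto
      also have "(\<Sum>i\<in>?I. (c(j := t)) i * m i b) = (\<Sum>i\<in>?I. c i * m i b)"
        by (intro sum.cong) auto
      finally show ?thesis .
    qed
    have "(\<Sum>i\<in>I. (c(j := t)) i * m i b) = 0" if "b \<in> insert a A" for b
    proof (cases "b = a")
      case True
      show ?thesis unfolding True sum_upd using j by (simp add: t_def)
    next
      case False
      have "(\<Sum>i\<in>?I. c i * (m i b - m i a / m j a * m j b))
          = (\<Sum>i\<in>?I. c i * m i b) + t * m j b"
        by (simp add: t_def algebra_simps sum_subtractf sum_distrib_left sum_divide_distrib)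
      then show ?thesis using c(2)[of b] False that by (simp add: sum_upd del: fun_upd_apply)
    qed
    then show ?thesis using c(1) by (intro exI[of _ "c(j := t)"]) auto
  qed
qed

text \<open>
  Caratheodory's theorem for cones: while the active vectors outnumber the coordinates, they are
  linearly dependent, and moving along a dependency until a weight reaches zero removes one.
\<close>

lemma conic_caratheodory:
  fixes m :: "'i \<Rightarrow> 'a \<Rightarrow> real"
  assumes "finite A" "finite I" "\<And>i. i \<in> I \<Longrightarrow> w i \<ge> 0"
  shows "\<exists>w'. (\<forall>i\<in>I. w' i \<ge> 0) \<and> card {i\<in>I. w' i > 0} \<le> card A \<and>
           (\<forall>a\<in>A. (\<Sum>i\<in>I. w' i * m i a) = (\<Sum>i\<in>I. w i * m i a))"
  using assms(3)
proof (induction "card {i\<in>I. w i > 0}" arbitrary: w rule: less_induct)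
  case less
  define J where "J = {i\<in>I. w i > 0}"
  have fin: "finite J" using assms(2) by (simp add: J_def)
  show ?case
  proof (cases "card J \<le> card A")
    case True
    then show ?thesis using less.prems by (auto simp: J_def intro!: exI[of _ w])
  next
    case False
    then obtain c0 where c0: "\<exists>i\<in>J. c0 i \<noteq> 0" "\<And>a. a \<in> A \<Longrightarrow> (\<Sum>i\<in>J. c0 i * m i a) = 0"
      using homogeneous_system_nontrivial_solution[OF assms(1) fin, of m] by auto
    obtain c where c: "\<exists>i\<in>J. c i > 0" "\<And>a. a \<in> A \<Longrightarrow> (\<Sum>i\<in>J. c i * m i a) = 0"
    proof (cases "\<exists>i\<in>J. c0 i > 0")
      case True
      then show ?thesis using that[of c0] c0 by blast
    next
      case False
      then have "\<exists>i\<in>J. - c0 i > 0" using c0(1) by force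
      then show ?thesis using that[of "\<lambda>i. - c0 i"] c0(2) by (simp add: sum_negf)
    qed
    define P where "P = {i\<in>J. c i > 0}"
    have P: "finite P" "P \<noteq> {}" using fin c(1) by (auto simp: P_def)
    obtain j where j: "j \<in> P" "\<And>i. i \<in> P \<Longrightarrow> w j / c j \<le> w i / c i"
      using that[of "arg_min_on (\<lambda>i. w i / c i) P"] arg_min_if_finite(1)[OF P]
        arg_min_least[OF P, of _ "\<lambda>i. w i / c i"] by blast
    \<comment> \<open>The largest step along the dependency that keeps all weights nonnegative; it cancels \<open>w j\<close>.\<close>
    define t where "t = w j / c j"
    have t: "t > 0" using j(1) by (auto simp: t_def P_def J_def)
    define w1 where "w1 i = (if i \<in> J then w i - t * c i else 0)" for i
    have w1: "w1 i \<ge> 0" if "i \<in> I" for i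
    proof (cases "i \<in> P")
      case True
      then show ?thesis using j(2)[OF True] by (auto simp: w1_def P_def t_def field_simps)
    next
      case False
      then have "t * c i \<le> 0" if "i \<in> J" using t that by (auto simp: P_def mult_le_0_iff not_less)
      then show ?thesis by (auto simp: w1_def J_def)
    qed
    have "{i\<in>I. w1 i > 0} \<subset> J"
    proof
      show "{i\<in>I. w1 i > 0} \<subseteq> J" by (auto simp: w1_def split: if_splits)
      have "j \<in> J" "w1 j = 0" using j(1) by (auto simp: w1_def t_def P_def)
      then show "{i\<in>I. w1 i > 0} \<noteq> J" by force
    qed
    then have "card {i\<in>I. w1 i > 0} < card {i\<in>I. w i > 0}"
      using fin unfolding J_def[symmetric] by (rule psubset_card_mono[rotated])
    then obtain w' where w': "\<forall>i\<in>I. w' i \<ge> 0" "card {i\<in>I. w' i > 0} \<le> card A"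
        "\<And>a. a \<in> A \<Longrightarrow> (\<Sum>i\<in>I. w' i * m i a) = (\<Sum>i\<in>I. w1 i * m i a)"
      using less.hyps[of w1] w1 by blast
    have "(\<Sum>i\<in>I. w1 i * m i a) = (\<Sum>i\<in>I. w i * m i a)" if a: "a \<in> A" for a
    proof -
      have "(\<Sum>i\<in>I. w1 i * m i a) = (\<Sum>i\<in>J. (w i - t * c i) * m i a)"
        using assms(2) by (intro sum.mono_neutral_cong_right) (auto simp: w1_def J_def)
      also have "\<dots> = (\<Sum>i\<in>J. w i * m i a) - t * (\<Sum>i\<in>J. c i * m i a)"
        by (simp add: algebra_simps sum_subtractf sum_distrib_left)
      also have "\<dots> = (\<Sum>i\<in>J. w i * m i a)" using c(2)[OF a] by simp
      also have "\<dots> = (\<Sum>i\<in>I. w i * m i a)"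
        using assms(2) less.prems by (intro sum.mono_neutral_left) (auto simp: J_def less_le)
      finally show ?thesis .
    qed
    then show ?thesis using w' by auto
  qed
qed

text \<open>
  The first-order condition at the left end of \<open>{0..1}\<close> for a quadratic that is minimal there.
\<close>

lemma nonneg_quadratic_slope:
  fixes a b :: real
  assumes "\<And>t. 0 < t \<Longrightarrow> t \<le> 1 \<Longrightarrow> 0 \<le> 2 * t * a + t\<^sup>2 * b"
  shows "0 \<le> a"
proof (rule ccontr)
  assume a: "\<not> 0 \<le> a"
  define t where "t = min 1 (- a / (\<bar>b\<bar> + 1))"
  have t: "0 < t" "t \<le> 1" "t \<le> - a / (\<bar>b\<bar> + 1)" using a by (auto simp: t_def divide_less_0_iff)
  have "t * b \<le> t * (\<bar>b\<bar> + 1)" using t by (intro mult_left_mono) auto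
  also have "\<dots> \<le> - a" by (rule iffD1[OF pos_le_divide_eq t(3)]) (simp add: add_nonneg_pos)
  finally have "t * (t * b) \<le> t * (- a)" using t by (intro mult_left_mono) auto
  then have "2 * t * a + t\<^sup>2 * b \<le> t * a" by (simp add: power2_eq_square algebra_simps)
  also have "\<dots> < 0" using t a by (simp add: mult_pos_neg)
  finally show False using assms[OF t(1,2)] by simp
qed

text \<open>
  A theorem of the alternative. The functional \<open>e\<close>, which is \<open>1\<close> on the generators, fixes the
  total weight of any representation of \<open>y\<close>, so the combinations of \<open>card A\<close> generators with this
  total weight form a compact set, on which the distance to \<open>y\<close> is minimal at some \<open>P\<close>. By
  Caratheodory's theorem \<open>P\<close> may be moved towards every generator, and the first-order condition
  says that the residual \<open>y - P\<close> separates \<open>y\<close> from all of them, up to a multiple of \<open>e\<close>.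
\<close>

lemma compact_cone_alternative:
  fixes v :: "'x::metric_space \<Rightarrow> 'a \<Rightarrow> real" and y e :: "'a \<Rightarrow> real"
  assumes A: "finite A" and W: "compact W"
    and cont: "\<And>a. a \<in> A \<Longrightarrow> continuous_on W (\<lambda>x. v x a)"
    and e: "\<And>x. x \<in> W \<Longrightarrow> (\<Sum>a\<in>A. e a * v x a) = 1"
    and c_pos: "(\<Sum>a\<in>A. e a * y a) > 0"
  obtains (representation) p w where "\<And>i. i < card A \<Longrightarrow> p i \<in> W" "\<And>i. i < card A \<Longrightarrow> w i \<ge> 0"
      "\<And>a. a \<in> A \<Longrightarrow> y a = (\<Sum>i<card A. w i * v (p i) a)"
  | (separation) h where "\<And>x. x \<in> W \<Longrightarrow> (\<Sum>a\<in>A. h a * v x a) < 0" "(\<Sum>a\<in>A. h a * y a) > 0"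
proof (cases "W = {}")
  case True
  with c_pos separation show ?thesis by blast
next
  case False
  define N where "N = card A"
  define c where "c = (\<Sum>a\<in>A. e a * y a)"
  have N: "N > 0" using c_pos A unfolding N_def by (metis card_gt_0_iff less_irrefl sum.empty)
  define comb where "comb z a = (\<Sum>i<N. snd (z i) * v (fst (z i)) a)" for z :: "nat \<Rightarrow> 'x \<times> real" and a
  define D where "D z = (\<Sum>a\<in>A. (y a - comb z a)\<^sup>2)" for z
  define Z where "Z = {z. (\<forall>i<N. fst (z i) \<in> W \<and> 0 \<le> snd (z i)) \<and> (\<Sum>i<N. snd (z i)) = c}"
  have weight: "(\<Sum>i\<in>I. w i) = (\<Sum>a\<in>A. e a * (\<Sum>i\<in>I. w i * v (p i) a))"
    if "\<And>i. i \<in> I \<Longrightarrow> p i \<in> W" for I :: "nat set" and w p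
  proof -
    have "(\<Sum>a\<in>A. e a * (\<Sum>i\<in>I. w i * v (p i) a)) = (\<Sum>i\<in>I. w i * (\<Sum>a\<in>A. e a * v (p i) a))"
      unfolding sum_distrib_left by (subst sum.swap) (simp add: mult_ac)
    then show ?thesis using e that by simp
  qed
  obtain x0 where x0: "x0 \<in> W" using False by blast
  have "(\<lambda>i. (x0, if i = 0 then c else 0)) \<in> Z"
    using x0 c_pos N by (auto simp: Z_def c_def sum.delta)
  then have Z_ne: "Z \<noteq> {}" by blast
  obtain z where z: "z \<in> Z" "\<And>z'. z' \<in> Z \<Longrightarrow> D z \<le> D z'"
  proof -
    have bdd: "bdd_below (D ` Z)" by (intro bdd_belowI[of _ 0]) (auto simp: D_def sum_nonneg)
    have "\<exists>z\<in>Z. D z < Inf (D ` Z) + 1 / real (Suc k)" for k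
      using cInf_less_iff[of "D ` Z" "Inf (D ` Z) + 1 / real (Suc k)"] Z_ne bdd by auto
    then obtain u where u: "\<And>k. u k \<in> Z" "\<And>k. D (u k) < Inf (D ` Z) + 1 / real (Suc k)" by metis
    have "u k i \<in> W \<times> {0..c}" if "i \<in> {..<N}" for k i
    proof -
      have "snd (u k i) \<le> (\<Sum>i<N. snd (u k i))"
        using u(1)[of k] that by (intro member_le_sum) (auto simp: Z_def)
      then show ?thesis using u(1)[of k] that by (auto simp: Z_def mem_Times_iff)
    qed
    then obtain r l where r: "strict_mono r"
      and l: "\<And>i. i < N \<Longrightarrow> l i \<in> W \<times> {0..c}" "\<And>i. i < N \<Longrightarrow> (\<lambda>k. u (r k) i) \<longlonglongrightarrow> l i"
      using compact_coordinates_convergent_subsequence[of "{..<N}" "\<lambda>_. W \<times> {0..c}" u] W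
      by (metis compact_Icc compact_Times finite_lessThan lessThan_iff)
    have "(\<lambda>k. \<Sum>i<N. snd (u (r k) i)) \<longlonglongrightarrow> (\<Sum>i<N. snd (l i))"
      by (intro tendsto_sum tendsto_snd l) auto
    then have "(\<Sum>i<N. snd (l i)) = c"
      using u(1) by (simp add: Z_def LIMSEQ_const_iff)
    then have "l \<in> Z" using l(1) by (auto simp: Z_def mem_Times_iff)
    have "(\<lambda>k. v (fst (u (r k) i)) a) \<longlonglongrightarrow> v (fst (l i)) a" if "i < N" "a \<in> A" for i a
      using cont[OF that(2)] l(1)[OF that(1)] tendsto_fst[OF l(2)[OF that(1)]] u(1) that(1)
      unfolding continuous_on_sequentially by (auto simp: Z_def mem_Times_iff o_def)
    then have "(\<lambda>k. D (u (r k))) \<longlonglongrightarrow> D l"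
      unfolding D_def comb_def by (intro tendsto_intros l) auto
    moreover have "(\<lambda>k. Inf (D ` Z) + 1 / real (Suc (r k))) \<longlonglongrightarrow> Inf (D ` Z) + 0"
      using LIMSEQ_subseq_LIMSEQ[OF LIMSEQ_Suc[OF lim_1_over_n] r]
      by (intro tendsto_intros) (simp add: o_def)
    ultimately have "D l \<le> Inf (D ` Z)"
      using u(2) by (intro LIMSEQ_le[where X = "\<lambda>k. D (u (r k))"]) (auto intro: less_imp_le)
    then show ?thesis
      using that[OF \<open>l \<in> Z\<close>] cInf_lower[OF _ bdd] by (meson imageI order_trans)
  qed
  define P where "P a = comb z a" for a
  define r where "r a = y a - P a" for a
  \<comment> \<open>An exchange step: a new generator can enter with weight \<open>t * c\<close> without exceeding \<open>N\<close> points.\<close>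
  have exchange: "\<exists>z'\<in>Z. \<forall>a\<in>A. comb z' a = (1 - t) * P a + t * c * v x a"
    if x: "x \<in> W" and t: "0 < t" "t \<le> 1" for x t
  proof -
    define p where "p i = (if i = N then x else fst (z i))" for i
    define w where "w i = (if i = N then t * c else (1 - t) * snd (z i))" for i
    have pW: "p i \<in> W" if "i \<in> {..N}" for i using that x z(1) by (auto simp: p_def Z_def)
    have w0: "w i \<ge> 0" if "i \<in> {..N}" for i
      using that t z(1) c_pos by (auto simp: w_def Z_def c_def[symmetric])
    have wsum: "(\<Sum>i\<le>N. w i * f (p i)) = (1 - t) * (\<Sum>i<N. snd (z i) * f (fst (z i))) + t * c * f x" for f
    proof -
      have "(\<Sum>i\<le>N. w i * f (p i)) = (\<Sum>i<N. w i * f (p i)) + t * c * f x"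
        by (simp add: lessThan_Suc_atMost[symmetric] p_def w_def)
      also have "(\<Sum>i<N. w i * f (p i)) = (1 - t) * (\<Sum>i<N. snd (z i) * f (fst (z i)))"
        unfolding sum_distrib_left by (intro sum.cong) (auto simp: p_def w_def)
      finally show ?thesis .
    qed
    obtain w' where w': "\<And>i. i \<in> {..N} \<Longrightarrow> w' i \<ge> 0" "card {i\<in>{..N}. w' i > 0} \<le> N"
      "\<And>a. a \<in> A \<Longrightarrow> (\<Sum>i\<le>N. w' i * v (p i) a) = (\<Sum>i\<le>N. w i * v (p i) a)"
      using conic_caratheodory[OF A, of "{..N}" w "\<lambda>i. v (p i)"] w0 unfolding N_def by blast
    have "{i\<in>{..N}. w' i > 0} \<noteq> {..N}" using w'(2) by auto
    then obtain j where j: "j \<le> N" "w' j = 0" using w'(1) by (force simp: less_le)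
    define \<sigma> where "\<sigma> i = (if i = j then N else i)" for i
    define z' where "z' i = (p (\<sigma> i), w' (\<sigma> i))" for i
    have \<sigma>: "bij_betw \<sigma> {..<N} ({..N} - {j})"
      using j(1) by (intro bij_betwI[of _ _ _ "\<lambda>i. if i = N then j else i"]) (auto simp: \<sigma>_def)
    have reindex: "(\<Sum>i<N. w' (\<sigma> i) * f (p (\<sigma> i))) = (\<Sum>i\<le>N. w' i * f (p i))" for f
    proof -
      have "(\<Sum>i<N. w' (\<sigma> i) * f (p (\<sigma> i))) = (\<Sum>i\<in>{..N} - {j}. w' i * f (p i))"
        using sum.reindex_bij_betw[OF \<sigma>, of "\<lambda>i. w' i * f (p i)"] .
      also have "\<dots> = (\<Sum>i\<le>N. w' i * f (p i))"
        using j by (intro sum.mono_neutral_left) auto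
      finally show ?thesis .
    qed
    have comb: "comb z' a = (1 - t) * P a + t * c * v x a" if "a \<in> A" for a
      using reindex[of "\<lambda>p. v p a"] w'(3)[OF that] wsum[of "\<lambda>p. v p a"]
      by (simp add: comb_def z'_def P_def)
    have "(\<Sum>i<N. w' (\<sigma> i)) = (\<Sum>i\<le>N. w' i)"
      using reindex[of "\<lambda>_. 1"] by simp
    also have "\<dots> = (\<Sum>a\<in>A. e a * (\<Sum>i\<le>N. w' i * v (p i) a))"
      by (rule weight) (use pW in auto)
    also have "\<dots> = (\<Sum>a\<in>A. e a * (\<Sum>i\<le>N. w i * v (p i) a))"
      using w'(3) by simp
    also have "\<dots> = (\<Sum>i\<le>N. w i)"
      by (rule weight[symmetric]) (use pW in auto)
    also have "\<dots> = c"
      using wsum[of "\<lambda>_. 1"] z(1) by (simp add: Z_def algebra_simps)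
    finally have "z' \<in> Z"
      using bij_betwE[OF \<sigma>] pW w'(1) by (auto simp: Z_def z'_def)
    with comb show ?thesis by blast
  qed
  define R where "R = (\<Sum>a\<in>A. (r a)\<^sup>2)"
  define ry where "ry = (\<Sum>a\<in>A. r a * y a)"
  have rP: "(\<Sum>a\<in>A. r a * P a) = ry - R"
    by (simp add: r_def R_def ry_def sum_subtractf[symmetric] power2_eq_square algebra_simps)
  have slope: "c * (\<Sum>a\<in>A. r a * v x a) \<le> ry - R" if x: "x \<in> W" for x
  proof -
    have "0 \<le> (\<Sum>a\<in>A. r a * (P a - c * v x a))"
    proof (rule nonneg_quadratic_slope)
      fix t :: real assume t: "0 < t" "t \<le> 1"
      obtain z' where z': "z' \<in> Z" "\<And>a. a \<in> A \<Longrightarrow> comb z' a = (1 - t) * P a + t * c * v x a"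
        using exchange[OF x t] by blast
      have "D z' = (\<Sum>a\<in>A. (r a + t * (P a - c * v x a))\<^sup>2)"
        unfolding D_def by (intro sum.cong refl arg_cong[where f="\<lambda>q. q\<^sup>2"])
          (auto simp: z'(2) r_def algebra_simps)
      also have "\<dots> = R + (2 * t * (\<Sum>a\<in>A. r a * (P a - c * v x a)) + t\<^sup>2 * (\<Sum>a\<in>A. (P a - c * v x a)\<^sup>2))"
        unfolding R_def sum_distrib_left sum.distrib[symmetric]
        by (intro sum.cong refl) (simp add: power2_eq_square algebra_simps)
      finally show "0 \<le> 2 * t * (\<Sum>a\<in>A. r a * (P a - c * v x a)) + t\<^sup>2 * (\<Sum>a\<in>A. (P a - c * v x a)\<^sup>2)"
        using z(2)[OF z'(1)] by (simp add: D_def R_def r_def P_def)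
    qed
    also have "\<dots> = (\<Sum>a\<in>A. r a * P a) - c * (\<Sum>a\<in>A. r a * v x a)"
      by (simp add: algebra_simps sum_subtractf sum_distrib_left)
    finally show ?thesis using rP by simp
  qed
  have "c > 0" using c_pos by (simp add: c_def)
  show ?thesis
  proof (cases "R = 0")
    case True
    then have "y a = comb z a" if "a \<in> A" for a
      using that A by (simp add: R_def sum_nonneg_eq_0_iff r_def P_def)
    then show ?thesis
      using representation[of "\<lambda>i. fst (z i)" "\<lambda>i. snd (z i)"] z(1)
      by (auto simp: comb_def Z_def N_def)
  next
    case False
    moreover have "R \<ge> 0" by (simp add: R_def sum_nonneg)
    ultimately have R: "R > 0" by simp
    \<comment> \<open>The quotient of \<open>r\<close> by \<open>e\<close> is at most \<open>(ry - R) / c\<close> on the generators and equals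
      \<open>ry / c\<close> at \<open>y\<close>; the separating level \<open>b\<close> is the midpoint of these two values.\<close>
    define b where "b = (ry - R / 2) / c"
    have h: "(\<Sum>a\<in>A. (r a - b * e a) * f a) = (\<Sum>a\<in>A. r a * f a) - b * (\<Sum>a\<in>A. e a * f a)" for f
      by (simp add: algebra_simps sum_subtractf sum_distrib_left)
    show ?thesis
    proof (rule separation[of "\<lambda>a. r a - b * e a"])
      fix x assume x: "x \<in> W"
      have "(\<Sum>a\<in>A. r a * v x a) \<le> (ry - R) / c"
        using slope[OF x] \<open>c > 0\<close> by (simp add: field_simps)
      also have "\<dots> < b" using R \<open>c > 0\<close> by (simp add: b_def divide_strict_right_mono)
      finally show "(\<Sum>a\<in>A. (r a - b * e a) * v x a) < 0"
        by (simp add: h e[OF x])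
    next
      have "(\<Sum>a\<in>A. (r a - b * e a) * y a) = ry - b * c"
        unfolding h by (simp add: ry_def c_def)
      also have "\<dots> = R / 2" using \<open>c > 0\<close> by (simp add: b_def)
      finally show "(\<Sum>a\<in>A. (r a - b * e a) * y a) > 0" using R by simp
    qed
  qed
qed

section \<open>The dominating form \<open>\<Sum>\<^sub>i x\<^sub>i ^ d\<close>\<close>

text \<open>
  A positive definite form for even \<open>d > 0\<close>; it plays the role of the \<open>d\<close>-th power of a norm and
  bounds every monomial of degree \<open>d\<close> directly.
\<close>

definition power_form :: "nat \<Rightarrow> real ^ 'n \<Rightarrow> real" where
  "power_form d x = (\<Sum>i\<in>UNIV. (x $ i) ^ d)"

lemma power_form_in_homog:
  assumes "d > 0" shows "(power_form d :: real ^ 'n \<Rightarrow> real) \<in> homog d"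
proof -
  define E :: "'n \<Rightarrow> 'n \<Rightarrow> nat" where "E i j = (if j = i then d else 0)" for i j
  have inj: "inj E" using assms by (auto simp: inj_def E_def fun_eq_iff split: if_splits)
  have E: "mdeg (E i) = d" "monomial (E i) x = (x $ i) ^ d" for i and x :: "real ^ 'n"
    by (simp_all add: mdeg_def monomial_def E_def if_distrib[of "\<lambda>k. _ ^ k"] cong: if_cong)
  have "form d (\<lambda>\<alpha>. if \<alpha> \<in> range E then 1 else 0) x = power_form d x" for x
  proof -
    have "form d (\<lambda>\<alpha>. if \<alpha> \<in> range E then 1 else 0) x = (\<Sum>\<alpha>\<in>range E. monomial \<alpha> x)"
      unfolding form_def using E(1)
      by (intro sum.mono_neutral_cong_right) (auto simp: finite_mdeg_eq)
    also have "\<dots> = power_form d x"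
      by (simp add: sum.reindex[OF inj] E power_form_def)
    finally show ?thesis .
  qed
  then show ?thesis unfolding homog_eq_range_form by (metis ext rangeI)
qed

lemma power_form_nonneg: "even d \<Longrightarrow> 0 \<le> power_form d x"
  by (simp add: power_form_def sum_nonneg zero_le_even_power)

lemma component_power_le_power_form: "even d \<Longrightarrow> (x $ i) ^ d \<le> power_form d x"
  unfolding power_form_def by (intro member_le_sum) (auto simp: zero_le_even_power)

text \<open>
  Every coordinate is bounded by the one of largest absolute value, whose \<open>d\<close>-th power is a
  summand of \<open>power_form d x\<close>.
\<close>

lemma abs_monomial_le_power_form:
  assumes "even d" "mdeg \<alpha> = d"
  shows "\<bar>monomial \<alpha> x\<bar> \<le> power_form d x"
proof -
  obtain j where j: "\<And>i. \<bar>x $ i\<bar> \<le> \<bar>x $ j\<bar>"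
    using arg_min_least[of UNIV _ "\<lambda>i. - \<bar>x $ i\<bar>"] by auto
  have "\<bar>monomial \<alpha> x\<bar> = (\<Prod>i\<in>UNIV. \<bar>x $ i\<bar> ^ \<alpha> i)"
    by (simp add: monomial_def abs_prod power_abs)
  also have "\<dots> \<le> (\<Prod>i\<in>UNIV. \<bar>x $ j\<bar> ^ \<alpha> i)"
    using j by (intro prod_mono conjI power_mono) auto
  also have "\<dots> = (x $ j) ^ d"
    using assms by (simp add: power_sum[symmetric] mdeg_def[symmetric] power_even_abs)
  also have "\<dots> \<le> power_form d x" by (rule component_power_le_power_form[OF assms(1)])
  finally show ?thesis .
qed

lemma homog_abs_le_power_form:
  assumes "even d" "f \<in> homog d"
  obtains C where "C \<ge> 0" "\<And>x. \<bar>f x\<bar> \<le> C * power_form d x"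
proof -
  obtain c where c: "f = form d c" using assms(2) by (auto simp: homog_eq_range_form)
  show ?thesis
  proof (rule that[of "\<Sum>\<alpha> | mdeg \<alpha> = d. \<bar>c \<alpha>\<bar>"])
    fix x :: "real ^ 'a"
    have "\<bar>f x\<bar> \<le> (\<Sum>\<alpha> | mdeg \<alpha> = d. \<bar>c \<alpha> * monomial \<alpha> x\<bar>)"
      unfolding c form_def by (rule sum_abs)
    also have "\<dots> \<le> (\<Sum>\<alpha> | mdeg \<alpha> = d. \<bar>c \<alpha>\<bar> * power_form d x)"
      unfolding abs_mult using assms(1) by (intro sum_mono mult_left_mono abs_monomial_le_power_form) auto
    finally show "\<bar>f x\<bar> \<le> (\<Sum>\<alpha> | mdeg \<alpha> = d. \<bar>c \<alpha>\<bar>) * power_form d x"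
      by (simp add: sum_distrib_right)
  qed (simp add: sum_nonneg)
qed

lemma norm_le_power_form:
  fixes x :: "real ^ 'n"
  assumes "even d" "d > 0"
  shows "norm x \<le> real CARD('n) * (power_form d x + 1)"
proof -
  have "\<bar>x $ i\<bar> \<le> power_form d x + 1" for i
  proof (cases "\<bar>x $ i\<bar> \<le> 1")
    case True
    then show ?thesis using power_form_nonneg[OF assms(1), of x] by simp
  next
    case False
    then have "\<bar>x $ i\<bar> \<le> \<bar>x $ i\<bar> ^ d" using assms(2) by (intro self_le_power) auto
    also have "\<dots> \<le> power_form d x"
      using component_power_le_power_form[OF assms(1)] assms(1) by (simp add: power_even_abs)
    finally show ?thesis by simp
  qed
  then have "(\<Sum>i\<in>UNIV. \<bar>x $ i\<bar>) \<le> (\<Sum>i\<in>(UNIV::'n set). power_form d x + 1)"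
    by (intro sum_mono)
  then show ?thesis using norm_le_l1_cart[of x] by simp
qed

text \<open>
  On the shell where \<open>norm x\<close> lies between \<open>k\<close> and \<open>k + 1\<close> the integrand is at most \<open>exp (- a * k)\<close>,
  while the volume of the ball containing it grows only polynomially in \<open>k\<close>.
\<close>

lemma integrable_exp_neg_norm:
  assumes "a > 0"
  shows "integrable lborel (\<lambda>x::'a::euclidean_space. exp (- a * norm x))"
proof (rule integrableI_bounded)
  show "(\<lambda>x::'a. exp (- a * norm x)) \<in> borel_measurable lborel" by measurable
  let ?V = "unit_ball_vol (real DIM('a))"
  define s where "s k = exp (- a * real k) * (?V * (real k + 1) ^ DIM('a))" for k
  have "summable s"
  proof (rule summable_comparison_test_ev)
    have "(\<lambda>k. ?V * (real k + 1) ^ DIM('a) * exp (- (a / 2) * real k)) \<longlonglongrightarrow> 0"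
      using assms by real_asymp
    then have "\<forall>\<^sub>F k in sequentially. ?V * (real k + 1) ^ DIM('a) * exp (- (a / 2) * real k) < 1"
      by (rule order_tendstoD) simp
    then show "\<forall>\<^sub>F k in sequentially. norm (s k) \<le> exp (- (a / 2)) ^ k"
    proof eventually_elim
      case (elim k)
      have "s k = ?V * (real k + 1) ^ DIM('a) * exp (- (a / 2) * real k) * exp (- (a / 2)) ^ k"
        by (simp add: s_def exp_of_nat_mult[symmetric] exp_add[symmetric] field_simps)
      also have "\<dots> \<le> 1 * exp (- (a / 2)) ^ k"
        using elim by (intro mult_right_mono) auto
      finally show ?case by (simp add: s_def)
    qed
    show "summable (\<lambda>k. exp (- (a / 2)) ^ k)"
      using assms by (intro summable_geometric) auto
  qed
  have "(\<integral>\<^sup>+ x. ennreal (norm (exp (- a * norm (x::'a)))) \<partial>lborel)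
      \<le> (\<integral>\<^sup>+ x. (\<Sum>k. ennreal (exp (- a * real k)) * indicator (ball 0 (real k + 1)) (x::'a)) \<partial>lborel)"
  proof (rule nn_integral_mono)
    fix x :: 'a
    define k where "k = nat \<lfloor>norm x\<rfloor>"
    have k: "real k \<le> norm x" "norm x < real k + 1" unfolding k_def by (auto simp: of_nat_floor)
    have "ennreal (norm (exp (- a * norm x))) \<le> ennreal (exp (- a * real k)) * indicator (ball 0 (real k + 1)) x"
      using k assms by (auto simp: indicator_def intro!: ennreal_leI)
    also have "\<dots> \<le> (\<Sum>k. ennreal (exp (- a * real k)) * indicator (ball 0 (real k + 1)) x)"
    proof -
      define F where "F k = ennreal (exp (- a * real k)) * indicator (ball 0 (real k + 1)) x" for k
      have "F k \<le> suminf F" using sum_le_suminf[of F "{k}"] by simp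
      then show ?thesis unfolding F_def[abs_def] .
    qed
    finally show "ennreal (norm (exp (- a * norm x)))
      \<le> (\<Sum>k. ennreal (exp (- a * real k)) * indicator (ball 0 (real k + 1)) x)" .
  qed
  also have "\<dots> = (\<Sum>k. ennreal (exp (- a * real k)) * emeasure lborel (ball 0 (real k + 1) :: 'a set))"
    by (subst nn_integral_suminf)
      (auto simp: nn_integral_cmult_indicator intro!: borel_measurable_times_ennreal borel_measurable_indicator)
  also have "\<dots> = (\<Sum>k. ennreal (s k))"
    by (intro suminf_cong) (simp add: emeasure_ball s_def ennreal_mult'[symmetric])
  also have "\<dots> < \<infinity>"
    using \<open>summable s\<close> by (subst suminf_ennreal2) (auto simp: s_def)
  finally show "(\<integral>\<^sup>+ x. ennreal (norm (exp (- a * norm (x::'a)))) \<partial>lborel) < \<infinity>" .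
qed

lemma integrable_exp_neg_power_form:
  assumes "even d" "d > 0" "\<epsilon> > 0"
  shows "integrable lborel (\<lambda>x::real^'n. exp (- \<epsilon> * power_form d x))"
proof (rule Bochner_Integration.integrable_bound)
  show "integrable lborel (\<lambda>x::real^'n. exp \<epsilon> * exp (- (\<epsilon> / real CARD('n)) * norm x))"
    using assms by (intro integrable_mult_right integrable_exp_neg_norm) auto
  show "(\<lambda>x::real^'n. exp (- \<epsilon> * power_form d x)) \<in> borel_measurable lborel"
    using borel_measurable_homog[OF power_form_in_homog[OF assms(2)]] by measurable
  have "exp (- \<epsilon> * power_form d x) \<le> exp (\<epsilon> + - (\<epsilon> / real CARD('n)) * norm x)" for x :: "real^'n"
  proof -
    have "norm x / real CARD('n) \<le> power_form d x + 1"
      using norm_le_power_form[OF assms(1,2), of x] by (simp add: field_simps)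
    then have "\<epsilon> * (norm x / real CARD('n)) \<le> \<epsilon> * (power_form d x + 1)"
      using assms(3) by (intro mult_left_mono) auto
    then show ?thesis by (simp add: algebra_simps)
  qed
  then show "AE x::real^'n in lborel. norm (exp (- \<epsilon> * power_form d x))
      \<le> norm (exp \<epsilon> * exp (- (\<epsilon> / real CARD('n)) * norm x))"
    by (intro AE_I2) (simp add: exp_add[symmetric])
qed

text \<open>
  Half of the exponent absorbs the polynomial factor, since \<open>u * exp (- u) \<le> 1\<close>.
\<close>

lemma integrable_power_form_exp:
  assumes "even d" "d > 0" "\<epsilon> > 0"
  shows "integrable lborel (\<lambda>x::real^'n. power_form d x * exp (- \<epsilon> * power_form d x))"
proof (rule Bochner_Integration.integrable_bound)
  show "integrable lborel (\<lambda>x::real^'n. 2 / \<epsilon> * exp (- (\<epsilon> / 2) * power_form d x))"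
    using assms by (intro integrable_mult_right integrable_exp_neg_power_form) auto
  show "(\<lambda>x::real^'n. power_form d x * exp (- \<epsilon> * power_form d x)) \<in> borel_measurable lborel"
    using borel_measurable_homog[OF power_form_in_homog[OF assms(2)]] by measurable
  have "power_form d x * exp (- \<epsilon> * power_form d x) \<le> 2 / \<epsilon> * exp (- (\<epsilon> / 2) * power_form d x)"
    for x :: "real^'n"
  proof -
    let ?u = "\<epsilon> / 2 * power_form d x"
    have "?u * exp (- ?u) \<le> 1"
      using exp_ge_add_one_self[of ?u] by (simp add: exp_minus field_simps)
    then have "?u * exp (- ?u) * exp (- ?u) \<le> 1 * exp (- ?u)"
      by (intro mult_right_mono) auto
    then show ?thesis using assms(3)
      by (simp add: mult.assoc exp_add[symmetric] field_simps)
  qed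
  then show "AE x::real^'n in lborel. norm (power_form d x * exp (- \<epsilon> * power_form d x))
      \<le> norm (2 / \<epsilon> * exp (- (\<epsilon> / 2) * power_form d x))"
    using assms(3) by (intro AE_I2) (simp add: abs_mult power_form_nonneg[OF assms(1)])
qed

section \<open>The integral of \<open>exp (- g)\<close>\<close>

lemma objective_eq_integral:
  assumes "integrable lborel (\<lambda>x. exp (- g x))"
  shows "objective g = ennreal (LINT x|lborel. exp (- g x))"
  unfolding objective_def using assms by (intro nn_integral_eq_integral) auto

lemma objective_finite_iff:
  assumes "g \<in> borel_measurable borel"
  shows "objective g < \<infinity> \<longleftrightarrow> integrable lborel (\<lambda>x. exp (- g x))"
  unfolding objective_def integrable_iff_bounded using assms by simp

text \<open>
  Markov's inequality: \<open>exp (- g)\<close> is at least \<open>exp (- 1)\<close> on the sublevel set.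
\<close>

lemma finite_volume_if_objective_finite:
  assumes g: "g \<in> homog d" and fin: "objective g < \<infinity>"
  shows "g \<in> finite_vol_homog d"
proof -
  note [measurable] = borel_measurable_homog[OF g]
  have "emeasure lborel {x. g x \<le> 1} = (\<integral>\<^sup>+ x. indicator {x. g x \<le> 1} x \<partial>lborel)"
    by simp
  also have "\<dots> \<le> (\<integral>\<^sup>+ x. ennreal (exp 1) * ennreal (exp (- g x)) \<partial>lborel)"
  proof (rule nn_integral_mono)
    fix x
    show "indicator {x. g x \<le> 1} x \<le> ennreal (exp 1) * ennreal (exp (- g x))"
      by (auto simp: indicator_def ennreal_mult'[symmetric] exp_add[symmetric] ennreal_1[symmetric] ennreal_leI simp del: ennreal_1)
  qed
  also have "\<dots> = ennreal (exp 1) * objective g"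
    unfolding objective_def by (rule nn_integral_cmult) simp
  also have "\<dots> < \<infinity>"
    using fin by (simp add: ennreal_mult_less_top)
  finally show ?thesis using g by (simp add: finite_vol_homog_def)
qed

text \<open>
  If \<open>g\<close> were negative at some point, then so it would be on a ball around it, and the dilations
  of this ball, of unbounded volume, would all lie in the sublevel set.
\<close>

lemma finite_volume_imp_nonneg:
  fixes g :: "real ^ 'n \<Rightarrow> real"
  assumes "g \<in> finite_vol_homog d"
  shows "g z \<ge> 0"
proof (rule ccontr)
  assume neg: "\<not> g z \<ge> 0"
  have g: "g \<in> homog d" and fin: "emeasure lborel {x. g x \<le> 1} < \<infinity>"
    using assms by (auto simp: finite_vol_homog_def)
  have "open {x. g x < 0}"
    using continuous_on_homog[OF g] by (intro open_Collect_less) auto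
  then obtain r where r: "r > 0" "ball z r \<subseteq> {x. g x < 0}"
    using neg open_contains_ball by (metis mem_Collect_eq not_le)
  have meas: "{x. g x \<le> 1} \<in> sets lborel"
    using borel_measurable_homog[OF g] by simp
  have bound: "ennreal (real k * (unit_ball_vol (real CARD('n)) * r ^ CARD('n))) \<le> emeasure lborel {x. g x \<le> 1}"
    if k: "k > 0" for k
  proof -
    have "ball (real k *\<^sub>R z) (real k * r) \<subseteq> {x. g x \<le> 1}"
    proof
      fix x assume x: "x \<in> ball (real k *\<^sub>R z) (real k * r)"
      define w where "w = (1 / real k) *\<^sub>R x"
      have xw: "x = real k *\<^sub>R w" using k by (simp add: w_def)
      have "norm (real k *\<^sub>R (z - w)) < real k * r"
        using x by (simp add: xw dist_norm scaleR_right_diff_distrib)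
      then have "w \<in> ball z r" using k by (simp add: dist_norm)
      then have "g w < 0" using r by auto
      then have "real k ^ d * g w \<le> 0" by (simp add: mult_nonneg_nonpos)
      then show "x \<in> {x. g x \<le> 1}" by (simp add: xw homog_scaleR[OF g])
    qed
    then have "emeasure lborel (ball (real k *\<^sub>R z) (real k * r)) \<le> emeasure lborel {x. g x \<le> 1}"
      using meas by (intro emeasure_mono) auto
    moreover have "emeasure lborel (ball (real k *\<^sub>R z) (real k * r))
        = ennreal (real k ^ CARD('n) * (unit_ball_vol (real CARD('n)) * r ^ CARD('n)))"
      using r(1) by (subst emeasure_ball) (auto simp: power_mult_distrib mult_ac)
    moreover have "real k * (unit_ball_vol (real CARD('n)) * r ^ CARD('n))
        \<le> real k ^ CARD('n) * (unit_ball_vol (real CARD('n)) * r ^ CARD('n))"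
      using r(1) k by (intro mult_right_mono self_le_power) auto
    ultimately show ?thesis by (metis ennreal_leI order_trans)
  qed
  define V where "V = unit_ball_vol (real CARD('n)) * r ^ CARD('n)"
  have V: "V > 0" using r(1) by (simp add: V_def)
  obtain m where m: "m \<ge> 0" "emeasure lborel {x. g x \<le> 1} = ennreal m"
    using fin by (cases "emeasure lborel {x. g x \<le> 1}") auto
  have km: "real k * V \<le> m" if "k > 0" for k
    using bound[OF that] m V by (simp add: V_def[symmetric] ennreal_le_iff)
  obtain k where k: "m < real k * V" using reals_Archimedean3[OF V] by blast
  then have "k > 0" using m(1) by (cases k) auto
  from km[OF this] k show False by simp
qed

lemma integral_scaleR:
  fixes F :: "'a::euclidean_space \<Rightarrow> real"
  assumes "F \<in> borel_measurable borel" "c > 0"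
  shows "(LINT x|lborel. F (c *\<^sub>R x)) = (LINT x|lborel. F x) / c ^ DIM('a)"
proof -
  have "(LINT x|lborel. F x)
      = (LINT x|density (distr lborel borel (\<lambda>x. 0 + c *\<^sub>R x)) (\<lambda>_. ennreal (\<bar>c\<bar> ^ DIM('a))). F x)"
    using assms by (subst lborel_affine[of c 0, symmetric]) auto
  also have "\<dots> = (LINT x|lborel. c ^ DIM('a) *\<^sub>R F (c *\<^sub>R x))"
    using assms by (simp add: integral_density integral_distr)
  finally show ?thesis using assms(2) by simp
qed

lemma abs_exp_minus_one_le: "\<bar>exp u - 1\<bar> \<le> \<bar>u\<bar> * exp \<bar>u\<bar>" for u :: real
proof (cases "u \<ge> 0")
  case True
  have "(1 - u) * exp u \<le> exp (- u) * exp u"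
    using exp_ge_add_one_self[of "- u"] by (intro mult_right_mono) auto
  then have "exp u - 1 \<le> u * exp u" by (simp add: exp_minus algebra_simps)
  then show ?thesis using True by simp
next
  case False
  have "1 - exp u \<le> \<bar>u\<bar> * 1" using exp_ge_add_one_self[of u] False by arith
  also have "\<dots> \<le> \<bar>u\<bar> * exp \<bar>u\<bar>" by (intro mult_left_mono) auto
  finally show ?thesis using False by simp
qed

text \<open>
  A form bounded below by a positive multiple of \<open>power_form d\<close> keeps this property, with half the
  constant, under all small perturbations by forms of the same degree. This uniform margin makes
  all integrals below converge and justifies differentiating them.
\<close>

locale coercive_form =
  fixes d :: nat and g :: "real ^ 'n \<Rightarrow> real" and \<epsilon> :: real
  assumes d: "even d" "d > 0"
    and homog: "g \<in> homog d"
    and \<epsilon>: "\<epsilon> > 0" "\<And>x. \<epsilon> * power_form d x \<le> g x"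
begin

lemma integrable_exp_neg: "integrable lborel (\<lambda>x. exp (- g x))"
proof (rule Bochner_Integration.integrable_bound[OF integrable_exp_neg_power_form[OF d \<epsilon>(1)]])
  show "(\<lambda>x. exp (- g x)) \<in> borel_measurable lborel"
    using borel_measurable_homog[OF homog] by measurable
qed (use \<epsilon>(2) in auto)

lemma integrable_homog_exp_neg:
  assumes "f \<in> homog d"
  shows "integrable lborel (\<lambda>x. f x * exp (- g x))"
proof -
  obtain C where C: "C \<ge> 0" "\<And>x. \<bar>f x\<bar> \<le> C * power_form d x"
    using homog_abs_le_power_form[OF d(1) assms] by blast
  show ?thesis
  proof (rule Bochner_Integration.integrable_bound)
    show "integrable lborel (\<lambda>x::real^'n. C * (power_form d x * exp (- \<epsilon> * power_form d x)))"
      by (intro integrable_mult_right integrable_power_form_exp d \<epsilon>)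
    show "(\<lambda>x. f x * exp (- g x)) \<in> borel_measurable lborel"
      using borel_measurable_homog[OF homog] borel_measurable_homog[OF assms] by measurable
    have "\<bar>f x * exp (- g x)\<bar> \<le> C * (power_form d x * exp (- \<epsilon> * power_form d x))" for x
      unfolding abs_mult mult.assoc[symmetric] using C \<epsilon>(2) power_form_nonneg[OF d(1)]
      by (intro mult_mono mult_nonneg_nonneg) auto
    then show "AE x in lborel. norm (f x * exp (- g x)) \<le> norm (C * (power_form d x * exp (- \<epsilon> * power_form d x)))"
      unfolding real_norm_def by (intro AE_I2 order_trans[OF _ abs_ge_self])
  qed
qed

lemma small_perturbation_bound:
  assumes "f \<in> homog d"
  obtains \<delta> where "\<delta> > 0"
    "\<And>t x. \<bar>t\<bar> < \<delta> \<Longrightarrow> \<bar>t\<bar> * \<bar>f x\<bar> \<le> \<epsilon> / 2 * power_form d x"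
proof -
  obtain C where C: "C \<ge> 0" "\<And>x. \<bar>f x\<bar> \<le> C * power_form d x"
    using homog_abs_le_power_form[OF d(1) assms] by blast
  show ?thesis
  proof (rule that[of "\<epsilon> / (2 * (C + 1))"])
    fix t x assume t: "\<bar>t\<bar> < \<epsilon> / (2 * (C + 1))"
    have "\<bar>t\<bar> * C \<le> \<bar>t\<bar> * (C + 1)" by (intro mult_left_mono) auto
    also have "\<dots> \<le> \<epsilon> / 2" using t C(1) by (simp add: field_simps)
    finally have tC: "\<bar>t\<bar> * C \<le> \<epsilon> / 2" .
    have "\<bar>t\<bar> * \<bar>f x\<bar> \<le> \<bar>t\<bar> * (C * power_form d x)"
      using C(2) by (intro mult_left_mono) auto
    also have "\<dots> \<le> \<epsilon> / 2 * power_form d x"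
      unfolding mult.assoc[symmetric] using tC power_form_nonneg[OF d(1)] by (intro mult_right_mono) auto
    finally show "\<bar>t\<bar> * \<bar>f x\<bar> \<le> \<epsilon> / 2 * power_form d x" .
  qed (use \<epsilon> C in auto)
qed

lemma perturbation_coercive:
  assumes "f \<in> homog d" "\<And>x. \<bar>t\<bar> * \<bar>f x\<bar> \<le> \<epsilon> / 2 * power_form d x"
  shows "coercive_form d (\<lambda>x. g x + t * f x) (\<epsilon> / 2)"
proof
  show "(\<lambda>x. g x + t * f x) \<in> homog d"
    using homog_lincomb[OF homog assms(1), of 1 t] by simp
  fix x
  have "\<bar>t * f x\<bar> \<le> \<epsilon> / 2 * power_form d x" using assms(2) by (simp add: abs_mult)
  then show "\<epsilon> / 2 * power_form d x \<le> g x + t * f x" using \<epsilon>(2)[of x] by (simp add: field_simps)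
qed (use d \<epsilon> in auto)

text \<open>
  Differentiation under the integral sign: for small \<open>t\<close> the difference quotients are dominated by
  a multiple of \<open>power_form d x * exp (- (\<epsilon> / 2) * power_form d x)\<close>.
\<close>

lemma derivative_integral_exp_neg:
  assumes f: "f \<in> homog d"
  shows "((\<lambda>t. LINT x|lborel. exp (- (g x + t * f x))) has_real_derivative
           - (LINT x|lborel. f x * exp (- g x))) (at 0)"
proof -
  note [measurable] = borel_measurable_homog[OF homog] borel_measurable_homog[OF f]
  let ?q = "power_form d"
  obtain C where C: "C \<ge> 0" "\<And>x. \<bar>f x\<bar> \<le> C * ?q x"
    using homog_abs_le_power_form[OF d(1) f] by blast
  obtain \<delta> where \<delta>: "\<delta> > 0" "\<And>t x. \<bar>t\<bar> < \<delta> \<Longrightarrow> \<bar>t\<bar> * \<bar>f x\<bar> \<le> \<epsilon> / 2 * ?q x"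
    using small_perturbation_bound[OF f] by blast
  define J where "J t = (LINT x|lborel. exp (- (g x + t * f x)))" for t
  have "((\<lambda>t. (J t - J 0) / t) \<longlongrightarrow> - (LINT x|lborel. f x * exp (- g x))) (at 0 within ball 0 \<delta>)"
    unfolding tendsto_at_iff_sequentially
  proof (intro allI impI)
    fix X assume X: "\<forall>i. X i \<in> ball 0 \<delta> - {0::real}" "X \<longlonglongrightarrow> 0"
    then have X0: "X i \<noteq> 0" "\<bar>X i\<bar> < \<delta>" for i by (auto simp: dist_norm)
    define s where "s i x = (exp (- (g x + X i * f x)) - exp (- g x)) / X i" for i x
    have J_eq: "(J (X i) - J 0) / X i = (LINT x|lborel. s i x)" for i
    proof -
      interpret p: coercive_form d "\<lambda>x. g x + X i * f x" "\<epsilon> / 2"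
        by (rule perturbation_coercive[OF f \<delta>(2)[OF X0(2)]])
      show ?thesis
        using p.integrable_exp_neg integrable_exp_neg by (simp add: J_def s_def)
    qed
    have "(\<lambda>i. LINT x|lborel. s i x) \<longlonglongrightarrow> (LINT x|lborel. - (f x * exp (- g x)))"
    proof (rule integral_dominated_convergence)
      show "integrable lborel (\<lambda>x::real^'n. C * (?q x * exp (- (\<epsilon> / 2) * ?q x)))"
        using \<epsilon>(1) by (intro integrable_mult_right integrable_power_form_exp d) auto
      show "AE x in lborel. (\<lambda>i. s i x) \<longlonglongrightarrow> - (f x * exp (- g x))"
      proof (rule AE_I2)
        fix x
        have "((\<lambda>t. exp (- (g x + t * f x))) has_real_derivative - (f x * exp (- g x))) (at 0)"
          by (auto intro!: derivative_eq_intros)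
        then have "((\<lambda>t. (exp (- (g x + t * f x)) - exp (- g x)) / t) \<longlongrightarrow> - (f x * exp (- g x))) (at 0)"
          by (simp add: DERIV_def)
        then show "(\<lambda>i. s i x) \<longlonglongrightarrow> - (f x * exp (- g x))"
          using X unfolding tendsto_at_iff_sequentially s_def by (auto simp: o_def)
      qed
      have "\<bar>s i x\<bar> \<le> C * (?q x * exp (- (\<epsilon> / 2) * ?q x))" for i x
      proof -
        have "s i x = exp (- g x) * (exp (- X i * f x) - 1) / X i"
          by (simp add: s_def exp_diff exp_minus field_simps exp_add)
        then have "\<bar>s i x\<bar> = exp (- g x) * \<bar>exp (- X i * f x) - 1\<bar> / \<bar>X i\<bar>"
          by (simp add: abs_mult)
        also have "\<dots> \<le> exp (- g x) * (\<bar>- X i * f x\<bar> * exp \<bar>- X i * f x\<bar>) / \<bar>X i\<bar>"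
          by (intro divide_right_mono mult_left_mono abs_exp_minus_one_le) auto
        also have "\<dots> = \<bar>f x\<bar> * exp (\<bar>X i\<bar> * \<bar>f x\<bar> - g x)"
          using X0(1)[of i] by (simp add: abs_mult exp_diff exp_minus field_simps)
        also have "\<dots> \<le> (C * ?q x) * exp (- (\<epsilon> / 2) * ?q x)"
          using C \<delta>(2)[OF X0(2), of i x] \<epsilon>(2)[of x] power_form_nonneg[OF d(1), of x]
          by (intro mult_mono) auto
        finally show ?thesis by simp
      qed
      then show "AE x in lborel. norm (s i x) \<le> C * (?q x * exp (- (\<epsilon> / 2) * ?q x))" for i
        by simp
    qed (auto simp: s_def)
    then show "((\<lambda>t. (J t - J 0) / t) \<circ> X) \<longlonglongrightarrow> - (LINT x|lborel. f x * exp (- g x))"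
      by (simp add: o_def J_eq)
  qed
  then show ?thesis
    using \<delta>(1) by (simp add: DERIV_def J_def at_within_open[of _ "ball 0 \<delta>"])
qed

text \<open>
  Euler's identity for the integral: scaling gives
  \<open>\<integral> exp (- s * g) = s powr (- n / d) * \<integral> exp (- g)\<close>, and both sides are differentiated at \<open>s = 1\<close>.
\<close>

lemma integral_form_exp_neg:
  "(LINT x|lborel. g x * exp (- g x)) = real CARD('n) / real d * (LINT x|lborel. exp (- g x))"
proof -
  note [measurable] = borel_measurable_homog[OF homog]
  define I where "I = (LINT x|lborel. exp (- g x))"
  let ?p = "- (real CARD('n) / real d)"
  have scale: "(LINT x|lborel. exp (- (g x + t * g x))) = (1 + t) powr ?p * I" if t: "t > -1" for t
  proof -
    define c where "c = (1 + t) powr (1 / real d)"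
    have c: "c > 0" "c ^ d = 1 + t"
      using t d(2) by (auto simp: c_def powr_realpow[symmetric] powr_powr)
    have "(LINT x|lborel. exp (- (g x + t * g x))) = (LINT x|lborel. exp (- g (c *\<^sub>R x)))"
      by (simp add: homog_scaleR[OF homog] c(2) algebra_simps)
    also have "\<dots> = I / c ^ CARD('n)"
      using c(1) by (subst integral_scaleR[where F = "\<lambda>x. exp (- g x)"]) (auto simp: I_def)
    also have "c ^ CARD('n) = (1 + t) powr (real CARD('n) / real d)"
      using t by (simp add: c_def powr_realpow[symmetric] powr_powr)
    finally show ?thesis by (simp add: powr_minus divide_inverse mult.commute)
  qed
  have "((\<lambda>t. (1 + t) powr ?p * I) has_real_derivative ?p * I) (at 0)"
    by (auto intro!: derivative_eq_intros)
  then have "((\<lambda>t. LINT x|lborel. exp (- (g x + t * g x))) has_real_derivative ?p * I) (at 0)"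
    by (rule has_field_derivative_transform_within[where d = 1]) (use scale in \<open>auto simp: dist_norm\<close>)
  from DERIV_unique[OF derivative_integral_exp_neg[OF homog] this] show ?thesis
    by (simp add: I_def)
qed

end

section \<open>Existence and uniqueness of the optimal solution\<close>

lemma optimal_solution_le:
  "optimal_solution d K g \<Longrightarrow> h \<in> feasible d K \<Longrightarrow> objective g \<le> objective h"
  unfolding optimal_solution_def by (metis INF_lower)

lemma optimal_solutionI:
  assumes "g \<in> feasible d K" "\<And>h. h \<in> feasible d K \<Longrightarrow> objective g \<le> objective h"
  shows "optimal_solution d K g"
  unfolding optimal_solution_def using assms by (auto intro!: antisym INF_greatest INF_lower)

lemma eq_if_AE_eq_continuous:
  fixes f g :: "'a::euclidean_space \<Rightarrow> real"
  assumes "continuous_on UNIV f" "continuous_on UNIV g" "AE x in lborel. f x = g x"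
  shows "f = g"
proof (rule ccontr)
  assume "f \<noteq> g"
  then have ne: "{x. f x \<noteq> g x} \<noteq> {}" by auto
  have op: "open {x. f x \<noteq> g x}"
    using assms(1,2) by (intro open_Collect_neq)
  then have "{x. f x \<noteq> g x} \<in> null_sets lborel"
    using assms(3) by (subst AE_iff_null_sets) auto
  then have "negligible {x. f x \<noteq> g x}"
    by (simp add: negligible_iff_null_sets null_sets_completionI)
  with op ne show False using open_not_negligible by blast
qed

text \<open>
  Strict convexity at the midpoint: the two integrals together exceed twice the integral at the
  midpoint by that of \<open>(exp (- g / 2) - exp (- h / 2))\<^sup>2\<close>.
\<close>

lemma optimal_solution_unique:
  assumes g: "optimal_solution d K g" and h: "optimal_solution d K h" and fin: "objective g < \<infinity>"
  shows "h = g"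
proof -
  have gh: "g \<in> homog d" "h \<in> homog d" "\<forall>x\<in>K. g x \<le> 1" "\<forall>x\<in>K. h x \<le> 1"
    using g h by (auto simp: optimal_solution_def feasible_iff)
  note [measurable] = borel_measurable_homog[OF gh(1)] borel_measurable_homog[OF gh(2)]
  have eq: "objective h = objective g" using g h by (simp add: optimal_solution_def)
  have int: "integrable lborel (\<lambda>x. exp (- g x))" "integrable lborel (\<lambda>x. exp (- h x))"
    using fin eq by (auto simp: objective_finite_iff[symmetric])
  define m where "m x = 1 / 2 * g x + 1 / 2 * h x" for x
  define a where "a x = exp (- g x / 2)" for x
  define b where "b x = exp (- h x / 2)" for x
  have m_feas: "m \<in> feasible d K"
    using homog_lincomb[OF gh(1,2), of "1 / 2" "1 / 2"] gh(3,4)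
    by (force simp: feasible_iff m_def[abs_def])
  have ab: "exp (- g x) = (a x)\<^sup>2" "exp (- h x) = (b x)\<^sup>2" "exp (- m x) = a x * b x" for x
    by (simp_all add: a_def b_def m_def power2_eq_square exp_add[symmetric] field_simps)
  have ab_bound: "exp (- m x) \<le> exp (- g x) + exp (- h x)" for x
  proof -
    have "0 \<le> (a x - b x)\<^sup>2 + (a x)\<^sup>2 + (b x)\<^sup>2" by simp
    then show ?thesis unfolding ab by (simp add: power2_eq_square algebra_simps)
  qed
  have int_m: "integrable lborel (\<lambda>x. exp (- m x))"
  proof (rule Bochner_Integration.integrable_bound)
    show "integrable lborel (\<lambda>x. exp (- g x) + exp (- h x))" using int by simp
    show "(\<lambda>x. exp (- m x)) \<in> borel_measurable lborel" unfolding m_def by measurable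
  qed (use ab_bound in \<open>auto intro!: AE_I2 simp: abs_of_nonneg add_nonneg_nonneg\<close>)
  have "objective g \<le> objective m" by (rule optimal_solution_le[OF g m_feas])
  then have le: "(LINT x|lborel. exp (- g x)) \<le> (LINT x|lborel. exp (- m x))"
    using int int_m by (simp add: objective_eq_integral ennreal_le_iff integral_nonneg_AE)
  have same: "(LINT x|lborel. exp (- h x)) = (LINT x|lborel. exp (- g x))"
    using eq int by (simp add: objective_eq_integral integral_nonneg_AE)
  have sq: "(a x - b x)\<^sup>2 = exp (- g x) + exp (- h x) - 2 * exp (- m x)" for x
    unfolding ab by (simp add: power2_eq_square algebra_simps)
  have int_sq: "integrable lborel (\<lambda>x. (a x - b x)\<^sup>2)"
    unfolding sq using int int_m by simp
  have "(LINT x|lborel. (a x - b x)\<^sup>2) \<le> 0"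
    unfolding sq using int int_m le same by simp
  then have "(LINT x|lborel. (a x - b x)\<^sup>2) = 0"
    by (intro antisym integral_nonneg_AE) auto
  then have "AE x in lborel. (a x - b x)\<^sup>2 = 0"
    using integral_nonneg_eq_0_iff_AE[OF int_sq] by simp
  then have "AE x in lborel. h x = g x"
    by eventually_elim (simp add: a_def b_def)
  then show ?thesis
    by (intro eq_if_AE_eq_continuous continuous_on_homog[OF gh(1)] continuous_on_homog[OF gh(2)])
qed

text \<open>
  The direct method. Feasible forms of finite objective take values in \<open>{0..1}\<close> on \<open>K\<close>, which
  contains a ball; hence their coefficients are bounded, a minimising sequence has a convergent
  subsequence, and Fatou's lemma applies to its limit.
\<close>

lemma optimal_solution_exists:
  fixes K :: "(real ^ 'n) set"
  assumes d: "d > 0" "even d" and K: "compact K" "interior K \<noteq> {}"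
  shows "\<exists>g. optimal_solution d K g \<and> objective g < \<infinity>"
proof -
  obtain B where B: "B \<ge> 0" "\<And>x. x \<in> K \<Longrightarrow> power_form d x \<le> B"
  proof -
    have "bounded (power_form d ` K)"
      by (intro compact_imp_bounded compact_continuous_image K continuous_on_homog[OF power_form_in_homog[OF d(1)]])
    then show ?thesis using that unfolding bounded_pos by (metis abs_le_D1 imageI less_imp_le real_norm_def)
  qed
  \<comment> \<open>A small multiple of \<open>power_form d\<close> is feasible and shows that the infimum is finite.\<close>
  define \<epsilon> where "\<epsilon> = 1 / (B + 1)"
  have \<epsilon>: "\<epsilon> > 0" using B(1) by (simp add: \<epsilon>_def)
  define g0 where "g0 x = \<epsilon> * power_form d x" for x :: "real ^ 'n"
  have "g0 \<in> homog d"
    using homog_lincomb[OF power_form_in_homog[OF d(1)] power_form_in_homog[OF d(1)], of \<epsilon> 0]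
    by (simp add: g0_def[abs_def])
  moreover have "g0 x \<le> 1" if "x \<in> K" for x
    using B(2)[OF that] B(1) by (simp add: g0_def \<epsilon>_def)
  ultimately have g0: "g0 \<in> feasible d K" by (simp add: feasible_iff)
  have "integrable lborel (\<lambda>x. exp (- g0 x))"
    using integrable_exp_neg_power_form[OF d(2,1) \<epsilon>] by (simp add: g0_def)
  then have g0_fin: "objective g0 < \<infinity>" by (simp add: objective_eq_integral)
  define \<rho> where "\<rho> = (INF h \<in> feasible d K. objective h)"
  have \<rho>: "\<rho> < \<infinity>" using INF_lower[OF g0, of objective] g0_fin by (simp add: \<rho>_def)
  obtain f :: "nat \<Rightarrow> ennreal" where f: "decseq f" "range f \<subseteq> objective ` feasible d K" "\<rho> = (INF i. f i)"
    using ennreal_Inf_countable_INF[of "objective ` feasible d K"] g0 unfolding \<rho>_def by auto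
  have "\<exists>h. h \<in> feasible d K \<and> objective h = f k" for k using f(2) by (metis image_iff range_subsetD)
  then obtain G where G: "\<And>k. G k \<in> feasible d K" "\<And>k. objective (G k) = f k" by metis
  have lim: "f \<longlonglongrightarrow> \<rho>" using LIMSEQ_INF[OF f(1)] f(3) by simp
  then obtain k0 where k0: "f k0 < \<infinity>"
    using order_tendstoD(2)[OF lim \<rho>] eventually_happens[of _ sequentially] by auto
  have fin: "objective (G (k + k0)) < \<infinity>" for k
    using decseqD[OF f(1), of k0 "k + k0"] k0 by (simp add: G(2) le_less_trans)
  have Gh: "G k \<in> homog d" for k using G(1) by (simp add: feasible_iff)
  then have "\<exists>c. G (k + k0) = form d c" for k by (auto simp: homog_eq_range_form)
  then obtain c where c: "\<And>k. G (k + k0) = form d (c k)" by metis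
  \<comment> \<open>Finiteness of the objective gives nonnegativity, and \<open>1\<close> is an upper bound on \<open>K\<close>.\<close>
  obtain x0 r0 where ball: "r0 > 0" "ball x0 r0 \<subseteq> K"
    using K(2) by (metis all_not_in_conv mem_interior)
  have "\<bar>form d (c k) x\<bar> \<le> 1" if "x \<in> ball x0 r0" for k x
  proof -
    have "form d (c k) x \<ge> 0"
      using finite_volume_imp_nonneg[OF finite_volume_if_objective_finite[OF Gh fin]] by (simp add: c[symmetric])
    moreover have "form d (c k) x \<le> 1"
      using G(1)[of "k + k0"] that ball(2) by (auto simp: feasible_iff c)
    ultimately show ?thesis by simp
  qed
  then obtain C where C: "\<And>k \<alpha>. mdeg \<alpha> = d \<Longrightarrow> \<bar>c k \<alpha>\<bar> \<le> C"
    using form_coeffs_bounded[OF ball(1), of x0 d] by blast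
  let ?A = "{\<alpha> :: 'n \<Rightarrow> nat. mdeg \<alpha> = d}"
  have "c k \<alpha> \<in> {-C..C}" if "\<alpha> \<in> ?A" for k \<alpha> using C[of \<alpha> k] that by (auto simp: abs_le_iff)
  then obtain r l where r: "strict_mono r" and l: "\<And>\<alpha>. \<alpha> \<in> ?A \<Longrightarrow> (\<lambda>k. c (r k) \<alpha>) \<longlonglongrightarrow> l \<alpha>"
    using compact_coordinates_convergent_subsequence[of ?A "\<lambda>_. {-C..C}" c] finite_mdeg_eq[where 'n='n]
    by (metis compact_Icc)
  define g where "g = form d l"
  have conv: "(\<lambda>k. form d (c (r k)) x) \<longlonglongrightarrow> g x" for x
    unfolding g_def form_def by (intro tendsto_sum tendsto_mult tendsto_const l)
  have "g x \<le> 1" if "x \<in> K" for x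
  proof (rule LIMSEQ_le_const2[OF conv])
    show "\<exists>N. \<forall>n\<ge>N. form d (c (r n)) x \<le> 1"
      using G(1) that by (auto simp: feasible_iff c[symmetric])
  qed
  then have g: "g \<in> feasible d K" by (auto simp: feasible_iff g_def homog_eq_range_form)
  have "objective g = (\<integral>\<^sup>+ x. liminf (\<lambda>k. ennreal (exp (- form d (c (r k)) x))) \<partial>lborel)"
    unfolding objective_def
    by (intro nn_integral_cong lim_imp_Liminf[symmetric] tendsto_ennrealI tendsto_intros conv) simp
  also have "\<dots> \<le> liminf (\<lambda>k. objective (form d (c (r k))))"
    unfolding objective_def
  proof (rule nn_integral_liminf)
    fix k
    have [measurable]: "form d (c (r k)) \<in> borel_measurable borel"
      using borel_measurable_homog[OF Gh, of "r k + k0"] by (simp add: c)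
    show "(\<lambda>x. ennreal (exp (- form d (c (r k)) x))) \<in> borel_measurable lborel" by measurable
  qed
  also have "\<dots> = \<rho>"
  proof (rule lim_imp_Liminf)
    have "(\<lambda>k. f (r k + k0)) \<longlonglongrightarrow> \<rho>"
      using LIMSEQ_subseq_LIMSEQ[OF LIMSEQ_ignore_initial_segment[OF lim] r] by (simp add: o_def)
    then show "(\<lambda>k. objective (form d (c (r k)))) \<longlonglongrightarrow> \<rho>"
      by (simp add: c[symmetric] G(2))
  qed simp
  finally have "objective g \<le> \<rho>" .
  then show ?thesis
    using g \<rho> INF_lower[OF g, of objective] by (intro exI[of _ g]) (auto simp: optimal_solution_def \<rho>_def)
qed

section \<open>Discrete measures\<close>

definition discrete_measure :: "nat \<Rightarrow> (nat \<Rightarrow> 'a::topological_space) \<Rightarrow> (nat \<Rightarrow> real) \<Rightarrow> 'a measure" where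
  "discrete_measure N p w = distr (point_measure {..<N} (\<lambda>i. ennreal (w i))) borel p"

lemma sets_discrete_measure [simp]: "sets (discrete_measure N p w) = sets borel"
  by (simp add: discrete_measure_def)

lemma measurable_point_measure: "p \<in> measurable (point_measure A f) borel"
  by (simp add: point_measure_def)

lemma emeasure_discrete_measure:
  assumes "\<And>i. i < N \<Longrightarrow> w i \<ge> 0" "U \<in> sets borel"
  shows "emeasure (discrete_measure N p w) U = ennreal (\<Sum>i | i < N \<and> p i \<in> U. w i)"
proof -
  have "emeasure (discrete_measure N p w) U
      = emeasure (point_measure {..<N} (\<lambda>i. ennreal (w i))) {i. i < N \<and> p i \<in> U}"
    unfolding discrete_measure_def using assms(2)
    by (subst emeasure_distr[OF measurable_point_measure])
      (auto simp: space_point_measure intro!: arg_cong[where f="emeasure _"])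
  also have "\<dots> = (\<Sum>i | i < N \<and> p i \<in> U. ennreal (w i))"
    by (intro emeasure_point_measure_finite) auto
  also have "\<dots> = ennreal (\<Sum>i | i < N \<and> p i \<in> U. w i)"
    using assms(1) by (intro sum_ennreal) auto
  finally show ?thesis .
qed

lemma finite_measure_discrete_measure:
  assumes "\<And>i. i < N \<Longrightarrow> w i \<ge> 0"
  shows "finite_measure (discrete_measure N p w)"
  by (rule finite_measureI) (simp add: emeasure_discrete_measure[OF assms] sets_eq_imp_space_eq[OF sets_discrete_measure])

lemma measure_support_discrete_measure:
  fixes p :: "nat \<Rightarrow> 'a::t1_space"
  assumes "\<And>i. i < N \<Longrightarrow> w i \<ge> 0"
  shows "measure_support (discrete_measure N p w) \<subseteq> p ` {..<N}"
proof
  fix x assume x: "x \<in> measure_support (discrete_measure N p w)"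
  show "x \<in> p ` {..<N}"
  proof (rule ccontr)
    assume "x \<notin> p ` {..<N}"
    moreover have op: "open (- (p ` {..<N}))"
      by (intro open_Compl finite_imp_closed) auto
    ultimately have "emeasure (discrete_measure N p w) (- (p ` {..<N})) > 0"
      using x unfolding measure_support_def by blast
    moreover have "(\<Sum>i | i < N \<and> p i \<in> - (p ` {..<N}). w i) = 0"
      by (rule sum.neutral) auto
    ultimately show False
      using emeasure_discrete_measure[OF assms borel_open[OF op], where p = p] by simp
  qed
qed

lemma set_integral_discrete_measure:
  fixes f :: "'a::topological_space \<Rightarrow> real"
  assumes "\<And>i. i < N \<Longrightarrow> w i \<ge> 0" "\<And>i. i < N \<Longrightarrow> p i \<in> K" "K \<in> sets borel" "f \<in> borel_measurable borel"
  shows "(LINT x:K|discrete_measure N p w. f x) = (\<Sum>i<N. w i * f (p i))"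
proof -
  have [measurable]: "(\<lambda>x. indicator K x *\<^sub>R f x) \<in> borel_measurable borel" using assms(3,4) by measurable
  have "(LINT x:K|discrete_measure N p w. f x)
      = (LINT i|point_measure {..<N} (\<lambda>i. ennreal (w i)). indicator K (p i) *\<^sub>R f (p i))"
    unfolding set_lebesgue_integral_def discrete_measure_def
    by (rule integral_distr[OF measurable_point_measure]) measurable
  also have "\<dots> = (\<Sum>i<N. w i *\<^sub>R (indicator K (p i) *\<^sub>R f (p i)))"
    using assms(1) by (intro lebesgue_integral_point_measure_finite) auto
  also have "\<dots> = (\<Sum>i<N. w i * f (p i))"
    using assms(2) by (intro sum.cong) auto
  finally show ?thesis .
qed

section \<open>Optimality conditions\<close>

text \<open>
  In the interior, a small multiple of \<open>power_form d\<close> may be subtracted without leaving the cone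
  of forms with finite volume, all of which are nonnegative.
\<close>

lemma interior_finite_volume_coercive:
  fixes g :: "real ^ 'n \<Rightarrow> real"
  assumes "d > 0" "g \<in> int_finite_vol_homog d"
  obtains \<epsilon> where "\<epsilon> > 0" "\<And>x. \<epsilon> * power_form d x \<le> g x"
proof -
  obtain T where T: "openin (top_of_set (homog d)) T" "g \<in> T" "T \<subseteq> finite_vol_homog d"
    using assms(2) unfolding int_finite_vol_homog_def interior_of_def by blast
  then obtain S where S: "open S" "T = homog d \<inter> S" by (metis openin_open)
  define path where "path t = (\<lambda>x. g x - t * power_form d x)" for t :: real
  have "continuous_on UNIV path"
    unfolding path_def by (intro continuous_on_coordinatewise_then_product continuous_intros)
  then have op: "open (path -` S)" using S(1) by (simp add: open_vimage)
  have g: "g \<in> homog d" "path 0 = g" using T(2) S(2) by (auto simp: path_def)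
  then have "0 \<in> path -` S" using T(2) S(2) by simp
  then obtain e where e: "e > 0" "ball 0 e \<subseteq> path -` S" using op open_contains_ball by metis
  define \<epsilon> where "\<epsilon> = e / 2"
  have "path \<epsilon> \<in> S" using e by (auto simp: \<epsilon>_def subset_iff dist_norm)
  moreover have "path \<epsilon> \<in> homog d"
    using homog_lincomb[OF g(1) power_form_in_homog[OF assms(1)], of 1 "- \<epsilon>"] by (simp add: path_def)
  ultimately have "path \<epsilon> \<in> finite_vol_homog d" using T(3) S(2) by blast
  then have "\<epsilon> * power_form d x \<le> g x" for x
    using finite_volume_imp_nonneg[of "path \<epsilon>" d x] by (simp add: path_def)
  then show ?thesis using that[of \<epsilon>] e(1) by (simp add: \<epsilon>_def)
qed

text \<open>
  Where \<open>h\<close> is negative, adding a positive multiple of it does no harm. On the rest of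
  \<open>K\<close>, which is compact and misses the contact set, \<open>g\<close> stays below \<open>1\<close> by a fixed amount, leaving room for a small multiple
  of \<open>h\<close>.
\<close>

lemma feasible_direction:
  assumes K: "compact K" and g: "g \<in> feasible d K" and h: "h \<in> homog d"
    and neg: "\<And>x. x \<in> K \<Longrightarrow> g x = 1 \<Longrightarrow> h x < 0"
  obtains \<delta> where "\<delta> > 0" "\<And>t. 0 < t \<Longrightarrow> t < \<delta> \<Longrightarrow> (\<lambda>x. g x + t * h x) \<in> feasible d K"
proof -
  have gh: "g \<in> homog d" "\<And>x. x \<in> K \<Longrightarrow> g x \<le> 1" using g by (auto simp: feasible_iff)
  define L where "L = {x\<in>K. 0 \<le> h x}"
  have "closed {x. 0 \<le> h x}"
    by (intro closed_Collect_le continuous_on_const continuous_on_homog[OF h])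
  then have L: "compact L" unfolding L_def Collect_conj_eq Collect_mem_eq using K by (rule compact_Int_closed[rotated])
  obtain \<delta> where \<delta>: "\<delta> > 0" "\<And>t x. 0 < t \<Longrightarrow> t < \<delta> \<Longrightarrow> x \<in> L \<Longrightarrow> g x + t * h x \<le> 1"
  proof (cases "L = {}")
    case True
    then show ?thesis using that[of 1] by simp
  next
    case False
    obtain a where a: "a \<in> L" "\<And>x. x \<in> L \<Longrightarrow> g x \<le> g a"
      using continuous_attains_sup[OF L False continuous_on_homog[OF gh(1)]] by blast
    obtain b where b: "b \<in> L" "\<And>x. x \<in> L \<Longrightarrow> h x \<le> h b"
      using continuous_attains_sup[OF L False continuous_on_homog[OF h]] by blast
    have ga: "g a < 1" using a(1) gh(2)[of a] neg[of a] by (force simp: L_def)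
    have hb: "0 \<le> h b" using b(1) by (simp add: L_def)
    show ?thesis
    proof (rule that[of "(1 - g a) / (h b + 1)"])
      show "0 < (1 - g a) / (h b + 1)" using ga hb by simp
      fix t x assume t: "0 < t" "t < (1 - g a) / (h b + 1)" and x: "x \<in> L"
      have "t * h x \<le> t * (h b + 1)" using b(2)[OF x] t(1) by (intro mult_left_mono) auto
      also have "\<dots> \<le> 1 - g a" using t(2) hb by (simp add: pos_less_divide_eq)
      finally show "g x + t * h x \<le> 1" using a(2)[OF x] by simp
    qed
  qed
  have "(\<lambda>x. g x + t * h x) \<in> feasible d K" if t: "0 < t" "t < \<delta>" for t
  proof -
    have "g x + t * h x \<le> 1" if x: "x \<in> K" for x
    proof (cases "0 \<le> h x")
      case True
      then show ?thesis using \<delta>(2)[OF t] x by (simp add: L_def)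
    next
      case False
      then have "t * h x \<le> 0" using t(1) by (simp add: mult_nonneg_nonpos)
      then show ?thesis using gh(2)[OF x] by simp
    qed
    then show ?thesis using homog_lincomb[OF gh(1) h, of 1 t] by (simp add: feasible_iff)
  qed
  then show ?thesis using that \<delta>(1) by blast
qed

text \<open>
  A small step along \<open>h\<close> stays feasible, and \<open>\<integral> h * exp (- g)\<close> is minus the derivative of the
  objective in this direction.
\<close>

lemma (in coercive_form) no_descent_direction:
  assumes K: "compact K" and opt: "optimal_solution d K g" and h: "h \<in> homog d"
    and neg: "\<And>x. x \<in> K \<Longrightarrow> g x = 1 \<Longrightarrow> h x < 0"
  shows "(LINT x|lborel. h x * exp (- g x)) \<le> 0"
proof (rule ccontr)
  assume "\<not> ?thesis"
  then have pos: "- (LINT x|lborel. h x * exp (- g x)) < 0" by simp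
  obtain \<delta>1 where \<delta>1: "\<delta>1 > 0" "\<And>t. 0 < t \<Longrightarrow> t < \<delta>1 \<Longrightarrow> (\<lambda>x. g x + t * h x) \<in> feasible d K"
    using feasible_direction[OF K _ h neg] opt unfolding optimal_solution_def by blast
  obtain \<delta>2 where \<delta>2: "\<delta>2 > 0" "\<And>t x. \<bar>t\<bar> < \<delta>2 \<Longrightarrow> \<bar>t\<bar> * \<bar>h x\<bar> \<le> \<epsilon> / 2 * power_form d x"
    using small_perturbation_bound[OF h] by blast
  obtain \<delta>3 where \<delta>3: "\<delta>3 > 0" "\<And>t. 0 < t \<Longrightarrow> t < \<delta>3 \<Longrightarrow>
      (LINT x|lborel. exp (- (g x + t * h x))) < (LINT x|lborel. exp (- g x))"
    using DERIV_neg_dec_right[OF derivative_integral_exp_neg[OF h] pos] by auto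
  define t where "t = min \<delta>1 (min \<delta>2 \<delta>3) / 2"
  have t: "0 < t" "t < \<delta>1" "\<bar>t\<bar> < \<delta>2" "t < \<delta>3" using \<delta>1(1) \<delta>2(1) \<delta>3(1) by (auto simp: t_def)
  interpret p: coercive_form d "\<lambda>x. g x + t * h x" "\<epsilon> / 2"
    by (rule perturbation_coercive[OF h \<delta>2(2)[OF t(3)]])
  have "objective g \<le> objective (\<lambda>x. g x + t * h x)"
    by (rule optimal_solution_le[OF opt \<delta>1(2)[OF t(1,2)]])
  then have "(LINT x|lborel. exp (- g x)) \<le> (LINT x|lborel. exp (- (g x + t * h x)))"
    unfolding objective_eq_integral[OF integrable_exp_neg] objective_eq_integral[OF p.integrable_exp_neg]
    by (subst (asm) ennreal_le_iff) (auto intro: integral_nonneg_AE)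
  with \<delta>3(2)[OF t(1,4)] show False by simp
qed

lemma (in coercive_form) integral_exp_neg_pos: "(LINT x|lborel. exp (- g x)) > 0"
proof -
  have "(LINT x|lborel. exp (- g x)) \<noteq> 0"
  proof
    assume "(LINT x|lborel. exp (- g x)) = 0"
    then have "AE x::real^'n in lborel. False"
      using integral_nonneg_eq_0_iff_AE[OF integrable_exp_neg] by simp
    then show False by (simp add: eventually_False ae_filter_eq_bot_iff)
  qed
  then show ?thesis using integral_nonneg_AE[where M = lborel and f = "\<lambda>x. exp (- g x)"] by (simp add: less_le)
qed

lemma monomial_in_homog:
  assumes "mdeg \<alpha> = d" shows "(monomial \<alpha> :: real ^ 'n \<Rightarrow> real) \<in> homog d"
proof -
  have "form d (\<lambda>\<beta>. if \<beta> = \<alpha> then 1 else 0) x = monomial \<alpha> x" for x :: "real ^ 'n"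
    using assms finite_mdeg_eq[where 'n='n]
    by (simp add: form_def if_distrib[of "\<lambda>c. c * _"] sum.delta cong: if_cong)
  then show ?thesis unfolding homog_eq_range_form by (metis ext rangeI)
qed

lemma (in coercive_form) integral_form_moments:
  "(LINT x|lborel. form d c x * exp (- g x))
     = (\<Sum>\<alpha> | mdeg \<alpha> = d. c \<alpha> * (LINT x|lborel. monomial \<alpha> x * exp (- g x)))"
proof -
  have "integrable lborel (\<lambda>x. monomial \<alpha> x * exp (- g x))" if "mdeg \<alpha> = d" for \<alpha>
    using that by (intro integrable_homog_exp_neg monomial_in_homog)
  then show ?thesis
    by (simp add: form_def sum_distrib_right mult.assoc Bochner_Integration.integral_sum)
qed

text \<open>
  Were the moment vector not in the cone generated by the contact set, a separating form would be
  a feasible direction of descent.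
\<close>

lemma (in coercive_form) optimality_representation:
  assumes K: "compact K" and opt: "optimal_solution d K g"
  obtains p w where
    "\<And>i. i < card {\<alpha> :: 'n \<Rightarrow> nat. mdeg \<alpha> = d} \<Longrightarrow> p i \<in> {x \<in> K. g x = 1} \<and> w i \<ge> 0"
    "\<And>f. f \<in> homog d \<Longrightarrow> (LINT x|lborel. f x * exp (- g x))
       = (\<Sum>i<card {\<alpha> :: 'n \<Rightarrow> nat. mdeg \<alpha> = d}. w i * f (p i))"
proof -
  let ?A = "{\<alpha> :: 'n \<Rightarrow> nat. mdeg \<alpha> = d}"
  define W where "W = {x \<in> K. g x = 1}"
  define y where "y \<alpha> = (LINT x|lborel. monomial \<alpha> x * exp (- g x))" for \<alpha>
  obtain e where e: "g = form d e" using homog by (auto simp: homog_eq_range_form)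
  have moments: "(LINT x|lborel. form d c x * exp (- g x)) = (\<Sum>\<alpha>\<in>?A. c \<alpha> * y \<alpha>)" for c
    unfolding y_def by (rule integral_form_moments)
  have "closed {x. g x = 1}"
    by (intro closed_Collect_eq continuous_on_const continuous_on_homog[OF homog])
  then have W: "compact W" unfolding W_def Collect_conj_eq Collect_mem_eq using K by (rule compact_Int_closed[rotated])
  have one: "(\<Sum>\<alpha>\<in>?A. e \<alpha> * monomial \<alpha> x) = 1" if "x \<in> W" for x
    using that by (simp add: W_def e form_def)
  have pos: "(\<Sum>\<alpha>\<in>?A. e \<alpha> * y \<alpha>) > 0"
  proof -
    have "0 < real CARD('n) / real d * (LINT x|lborel. exp (- g x))"
      using integral_exp_neg_pos d(2) by (intro mult_pos_pos divide_pos_pos) auto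
    also have "\<dots> = (\<Sum>\<alpha>\<in>?A. e \<alpha> * y \<alpha>)"
      using moments[of e] integral_form_exp_neg by (simp only: e[symmetric])
    finally show ?thesis .
  qed
  show ?thesis
  proof (rule compact_cone_alternative[OF finite_mdeg_eq W continuous_on_monomial one pos])
    fix p w
    assume pw: "\<And>i. i < card ?A \<Longrightarrow> p i \<in> W" "\<And>i. i < card ?A \<Longrightarrow> w i \<ge> 0"
      "\<And>\<alpha>. \<alpha> \<in> ?A \<Longrightarrow> y \<alpha> = (\<Sum>i<card ?A. w i * monomial \<alpha> (p i))"
    show thesis
    proof (rule that[of p w])
      fix f :: "real ^ 'n \<Rightarrow> real" assume "f \<in> homog d"
      then obtain c where c: "f = form d c" by (auto simp: homog_eq_range_form)
      have "(LINT x|lborel. f x * exp (- g x)) = (\<Sum>\<alpha>\<in>?A. c \<alpha> * (\<Sum>i<card ?A. w i * monomial \<alpha> (p i)))"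
        unfolding c moments using pw(3) by (intro sum.cong) auto
      also have "\<dots> = (\<Sum>i<card ?A. w i * f (p i))"
        unfolding c form_def sum_distrib_left by (subst sum.swap) (simp add: mult_ac)
      finally show "(LINT x|lborel. f x * exp (- g x)) = (\<Sum>i<card ?A. w i * f (p i))" .
    qed (use pw in \<open>auto simp: W_def\<close>)
  next
    fix h
    assume h: "\<And>x. x \<in> W \<Longrightarrow> (\<Sum>\<alpha>\<in>?A. h \<alpha> * monomial \<alpha> x) < 0" "(\<Sum>\<alpha>\<in>?A. h \<alpha> * y \<alpha>) > 0"
    have "form d h \<in> homog d" by (simp add: homog_eq_range_form)
    then have "(LINT x|lborel. form d h x * exp (- g x)) \<le> 0"
      by (rule no_descent_direction[OF K opt]) (use h(1) in \<open>auto simp: W_def form_def\<close>)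
    with h(2) show thesis by (simp add: moments)
  qed
qed

text \<open>
  The total mass follows from the moments: \<open>g\<close> equals \<open>1\<close> at every atom, so the mass is
  \<open>\<Sum>i. w i * g (p i) = \<integral> g * exp (- g)\<close>, to which Euler's identity applies.
\<close>

lemma (in coercive_form) optimality_conditions_discrete_measure:
  assumes K: "compact K" and opt: "optimal_solution d K g"
  shows "\<exists>\<mu> \<in> finite_borel_measures_on K. optimality_conditions d K g \<mu> \<and>
           measure_support \<mu> \<subseteq> {x \<in> K. g x = 1} \<and> finite (measure_support \<mu>) \<and>
           card (measure_support \<mu>) \<le> (CARD('n) + d - 1) choose d"
proof -
  define N where "N = card {\<alpha> :: 'n \<Rightarrow> nat. mdeg \<alpha> = d}"
  obtain p w where p: "\<And>i. i < N \<Longrightarrow> p i \<in> {x \<in> K. g x = 1}" and w: "\<And>i. i < N \<Longrightarrow> w i \<ge> 0"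
    and rep: "\<And>f. f \<in> homog d \<Longrightarrow> (LINT x|lborel. f x * exp (- g x)) = (\<Sum>i<N. w i * f (p i))"
  proof (rule optimality_representation[OF K opt, folded N_def])
    fix p w
    assume "\<And>i. i < N \<Longrightarrow> p i \<in> {x \<in> K. g x = 1} \<and> w i \<ge> 0"
      "\<And>f. f \<in> homog d \<Longrightarrow> (LINT x|lborel. f x * exp (- g x)) = (\<Sum>i<N. w i * f (p i))"
    then show thesis by (intro that[of p w]) auto
  qed
  define \<mu> where "\<mu> = discrete_measure N p w"
  have K_borel: "K \<in> sets borel" using K by (simp add: borel_compact)
  note [measurable] = borel_measurable_homog[OF homog]
  have integral: "(LINT x:K|\<mu>. f x) = (\<Sum>i<N. w i * f (p i))" if "f \<in> borel_measurable borel" for f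
    unfolding \<mu>_def using p by (intro set_integral_discrete_measure w K_borel that) auto
  have support: "measure_support \<mu> \<subseteq> p ` {..<N}"
    unfolding \<mu>_def by (rule measure_support_discrete_measure) (rule w)
  have "{i. i < N \<and> p i \<in> K} = {..<N}" using p by auto
  then have "measure \<mu> K = (\<Sum>i<N. w i)"
    using emeasure_discrete_measure[of N w K p, OF w K_borel] sum_nonneg[of "{..<N}" w] w
    by (simp add: measure_def \<mu>_def)
  also have "\<dots> = (\<Sum>i<N. w i * g (p i))" using p by (intro sum.cong) auto
  also have "\<dots> = real CARD('n) / real d * (LINT x|lborel. exp (- g x))"
    using rep[OF homog] integral_form_exp_neg by simp
  finally have mass: "measure \<mu> K = real CARD('n) / real d * (LINT x|lborel. exp (- g x))" .
  have "has_bochner_integral lborel (\<lambda>x. monomial \<alpha> x * exp (- g x)) (LINT x:K|\<mu>. monomial \<alpha> x)"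
    if "mdeg \<alpha> = d" for \<alpha>
    using integrable_homog_exp_neg[OF monomial_in_homog[OF that]] rep[OF monomial_in_homog[OF that]]
    by (simp add: has_bochner_integral_iff integral)
  moreover have "(LINT x:K|\<mu>. 1 - g x) = 0"
    using p by (subst integral) (auto intro!: sum.neutral)
  ultimately have "optimality_conditions d K g \<mu>"
    using mass integrable_exp_neg by (simp add: optimality_conditions_def)
  moreover have "\<mu> \<in> finite_borel_measures_on K"
    using support p finite_measure_discrete_measure[OF w]
    by (auto simp: finite_borel_measures_on_def \<mu>_def)
  moreover have "finite (measure_support \<mu>)" "card (measure_support \<mu>) \<le> N"
    using support surj_card_le[of "{..<N}" "measure_support \<mu>" p] by (auto intro: finite_subset)
  moreover have "measure_support \<mu> \<subseteq> {x \<in> K. g x = 1}" using support p by blast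
  ultimately show ?thesis
    using card_mdeg_eq[of d, where 'n='n] unfolding N_def by auto
qed

lemma has_bochner_integral_form:
  assumes "\<And>\<alpha>. mdeg \<alpha> = d \<Longrightarrow> has_bochner_integral lborel (\<lambda>x. monomial \<alpha> x * exp (- g x))
             (\<Sum>i=1..s. w i * monomial \<alpha> (p i))"
    and "f \<in> homog d"
  shows "has_bochner_integral lborel (\<lambda>x. f x * exp (- g x)) (\<Sum>i=1..s. w i * f (p i))"
proof -
  obtain c where c: "f = form d c" using assms(2) by (auto simp: homog_eq_range_form)
  have "has_bochner_integral lborel (\<lambda>x. \<Sum>\<alpha> | mdeg \<alpha> = d. c \<alpha> * (monomial \<alpha> x * exp (- g x)))
      (\<Sum>\<alpha> | mdeg \<alpha> = d. c \<alpha> * (\<Sum>i=1..s. w i * monomial \<alpha> (p i)))"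
    using assms(1) by (intro has_bochner_integral_sum has_bochner_integral_mult_right) auto
  moreover have "(\<Sum>\<alpha> | mdeg \<alpha> = d. c \<alpha> * (\<Sum>i=1..s. w i * monomial \<alpha> (p i))) = (\<Sum>i=1..s. w i * f (p i))"
    unfolding c form_def sum_distrib_left by (subst sum.swap) (simp add: mult_ac)
  ultimately show ?thesis by (simp add: c form_def sum_distrib_right mult.assoc)
qed

text \<open>
  Outside a large ball \<open>power_form d\<close> is at least \<open>1\<close>, so the moments of order \<open>d\<close> control the
  integral of \<open>exp (- g)\<close> there.
\<close>

lemma integrable_exp_neg_if_moment:
  fixes g :: "real ^ 'n \<Rightarrow> real"
  assumes d: "even d" "d > 0" and g: "g \<in> homog d"
    and int: "integrable lborel (\<lambda>x. power_form d x * exp (- g x))"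
  shows "integrable lborel (\<lambda>x. exp (- g x))"
proof -
  \<comment> \<open>Beyond this radius \<open>norm_le_power_form\<close> forces \<open>power_form d x\<close> to be at least \<open>1\<close>.\<close>
  define R where "R = 2 * real CARD('n)"
  have "bounded ((\<lambda>x. exp (- g x)) ` cball 0 R)"
    by (intro compact_imp_bounded compact_continuous_image continuous_intros continuous_on_homog[OF g]) auto
  then obtain B where B: "B > 0" "\<forall>x\<in>cball 0 R. exp (- g x) \<le> B"
    unfolding bounded_pos by auto
  show ?thesis
  proof (rule Bochner_Integration.integrable_bound)
    show "integrable lborel (\<lambda>x::real^'n. B * indicator (cball 0 R) x + power_form d x * exp (- g x))"
      using int by (intro Bochner_Integration.integrable_add integrable_mult_right integrable_real_indicator)
        (auto intro!: emeasure_bounded_finite[THEN order_less_le_trans])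
    show "(\<lambda>x. exp (- g x)) \<in> borel_measurable lborel"
      using borel_measurable_homog[OF g] by measurable
    have "exp (- g x) \<le> B * indicator (cball 0 R) x + power_form d x * exp (- g x)" for x :: "real ^ 'n"
    proof (cases "x \<in> cball 0 R")
      case True
      then show ?thesis using B True power_form_nonneg[OF d(1), of x] by (simp add: add_increasing2)
    next
      case False
      then have "2 * real CARD('n) < norm x" by (simp add: R_def)
      then have "real CARD('n) * 2 < real CARD('n) * (power_form d x + 1)"
        using norm_le_power_form[OF d, of x] by linarith
      then have "2 < power_form d x + 1" by (rule mult_left_less_imp_less) simp
      then have "1 * exp (- g x) \<le> power_form d x * exp (- g x)" by (intro mult_right_mono) auto
      then show ?thesis using False by simp
    qed
    then show "AE x in lborel. norm (exp (- g x)) \<le> norm (B * indicator (cball 0 R) x + power_form d x * exp (- g x))"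
      unfolding real_norm_def abs_exp_cancel by (intro AE_I2 order_trans[OF _ abs_ge_self])
  qed
qed

text \<open>
  Sufficiency: the tangent inequality \<open>exp (- h) \<ge> exp (- g) * (1 + g - h)\<close> reduces optimality to
  \<open>\<integral> (g - h) * exp (- g) \<ge> 0\<close>, and the representation turns this integral into
  a combination of the values \<open>1 - h (p i) \<ge> 0\<close>.
\<close>

lemma unique_optimal_solution_if_representation:
  fixes K :: "(real ^ 'n) set" and s :: nat
  assumes d: "even d" "d > 0" and feas: "g \<in> feasible d K"
    and p: "\<And>i. i \<in> {1..s} \<Longrightarrow> p i \<in> K \<and> w i > 0 \<and> g (p i) = 1"
    and moments: "\<And>\<alpha>. mdeg \<alpha> = d \<Longrightarrow> has_bochner_integral lborel
      (\<lambda>x. monomial \<alpha> x * exp (- g x)) (\<Sum>i=1..s. w i * monomial \<alpha> (p i))"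
  shows "unique_optimal_solution d K g"
proof -
  have g: "g \<in> homog d" using feas by (simp add: feasible_iff)
  have rep: "has_bochner_integral lborel (\<lambda>x. f x * exp (- g x)) (\<Sum>i=1..s. w i * f (p i))"
    if "f \<in> homog d" for f
    by (rule has_bochner_integral_form[OF _ that]) (rule moments)
  have int: "integrable lborel (\<lambda>x. exp (- g x))"
    using integrable_exp_neg_if_moment[OF d g] rep[OF power_form_in_homog[OF d(2)]]
    by (simp add: has_bochner_integral_iff)
  have opt: "optimal_solution d K g"
  proof (rule optimal_solutionI[OF feas])
    fix h assume "h \<in> feasible d K"
    then have h: "h \<in> homog d" "\<And>x. x \<in> K \<Longrightarrow> h x \<le> 1" by (auto simp: feasible_iff)
    show "objective g \<le> objective h"
    proof (cases "objective h < \<infinity>")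
      case True
      then have int_h: "integrable lborel (\<lambda>x. exp (- h x))"
        using objective_finite_iff[OF borel_measurable_homog[OF h(1)]] by blast
      have "(\<lambda>x. g x - h x) \<in> homog d" using homog_lincomb[OF g h(1), of 1 "-1"] by simp
      note diff = rep[OF this]
      have "0 \<le> (\<Sum>i=1..s. w i * (g (p i) - h (p i)))"
        using p h(2) by (intro sum_nonneg mult_nonneg_nonneg) (auto simp: less_imp_le)
      then have "(LINT x|lborel. exp (- g x)) + 0 \<le> (LINT x|lborel. exp (- g x)) + (LINT x|lborel. (g x - h x) * exp (- g x))"
        using diff by (intro add_left_mono) (simp add: has_bochner_integral_iff)
      also have "\<dots> = (LINT x|lborel. exp (- g x) + (g x - h x) * exp (- g x))"
        using int diff by (simp add: has_bochner_integral_iff)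
      also have "\<dots> \<le> (LINT x|lborel. exp (- h x))"
      proof (rule integral_mono)
        fix x
        have "(1 + (g x - h x)) * exp (- g x) \<le> exp (g x - h x) * exp (- g x)"
          by (intro mult_right_mono exp_ge_add_one_self) auto
        also have "\<dots> = exp (- h x)" by (simp add: exp_add[symmetric])
        finally show "exp (- g x) + (g x - h x) * exp (- g x) \<le> exp (- h x)" by (simp add: algebra_simps)
      qed (use int int_h diff in \<open>auto simp: has_bochner_integral_iff\<close>)
      finally show ?thesis
        by (simp add: objective_eq_integral[OF int] objective_eq_integral[OF int_h] ennreal_leI)
    qed (simp add: not_less top_unique)
  qed
  moreover have "objective g < \<infinity>" by (simp add: objective_eq_integral[OF int])
  ultimately show ?thesis
    using optimal_solution_unique by (auto simp: unique_optimal_solution_def)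
qed

theorem theorem3p2:
  fixes d :: nat and K :: "(real ^ 'n) set"
  assumes "d > 0" and "even d" and "compact K" and "interior K \<noteq> {}"
  shows
    "(\<exists>g \<in> finite_vol_homog d. unique_optimal_solution d K g)
   \<and> (\<forall>g \<in> finite_vol_homog d.
        unique_optimal_solution d K g \<longrightarrow> g \<in> int_finite_vol_homog d \<longrightarrow>
        (\<exists>\<mu> \<in> finite_borel_measures_on K.
           optimality_conditions d K g \<mu> \<and>
           measure_support \<mu> \<subseteq> {x \<in> K. g x = 1} \<and>
           (\<exists>\<nu> \<in> finite_borel_measures_on K.
              optimality_conditions d K g \<nu> \<and>
              measure_support \<nu> \<subseteq> {x \<in> K. g x = 1} \<and>
              finite (measure_support \<nu>) \<and>
              card (measure_support \<nu>) \<le> (CARD('n) + d - 1) choose d)))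
   \<and> (\<forall>g \<in> homog d. \<forall>(s::nat) (p :: nat \<Rightarrow> real ^ 'n) (w :: nat \<Rightarrow> real).
        (\<lambda>x. 1 - g x) \<in> nonneg_polys d K \<longrightarrow>
        (\<forall>i\<in>{1..s}. p i \<in> K \<and> w i > 0 \<and> g (p i) = 1) \<longrightarrow>
        (\<forall>\<alpha>. mdeg \<alpha> = d \<longrightarrow>
           has_bochner_integral lborel (\<lambda>x. monomial \<alpha> x * exp (- g x))
             (\<Sum>i=1..s. w i * monomial \<alpha> (p i))) \<longrightarrow>
        unique_optimal_solution d K g)"
proof (intro conjI ballI allI impI)
  obtain g where g: "optimal_solution d K g" "objective g < \<infinity>"
    using optimal_solution_exists[OF assms] by blast
  have "g \<in> homog d" using g(1) by (simp add: optimal_solution_def feasible_iff)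
  then have "g \<in> finite_vol_homog d" using finite_volume_if_objective_finite g(2) by blast
  moreover have "unique_optimal_solution d K g"
    using g optimal_solution_unique by (auto simp: unique_optimal_solution_def)
  ultimately show "\<exists>g \<in> finite_vol_homog d. unique_optimal_solution d K g" by blast
next
  fix g :: "real ^ 'n \<Rightarrow> real"
  assume g: "g \<in> finite_vol_homog d" "unique_optimal_solution d K g" "g \<in> int_finite_vol_homog d"
  obtain \<epsilon> where \<epsilon>: "\<epsilon> > 0" "\<And>x. \<epsilon> * power_form d x \<le> g x"
    using interior_finite_volume_coercive[OF assms(1) g(3)] by blast
  interpret coercive_form d g \<epsilon>
    using assms \<epsilon> g(1) by unfold_locales (auto simp: finite_vol_homog_def)
  show "\<exists>\<mu> \<in> finite_borel_measures_on K.
           optimality_conditions d K g \<mu> \<and>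
           measure_support \<mu> \<subseteq> {x \<in> K. g x = 1} \<and>
           (\<exists>\<nu> \<in> finite_borel_measures_on K.
              optimality_conditions d K g \<nu> \<and>
              measure_support \<nu> \<subseteq> {x \<in> K. g x = 1} \<and>
              finite (measure_support \<nu>) \<and>
              card (measure_support \<nu>) \<le> (CARD('n) + d - 1) choose d)"
    using optimality_conditions_discrete_measure[OF assms(3)] g(2)
    unfolding unique_optimal_solution_def by blast
next
  fix g :: "real ^ 'n \<Rightarrow> real" and s :: nat and p :: "nat \<Rightarrow> real ^ 'n" and w :: "nat \<Rightarrow> real"
  assume "g \<in> homog d" "(\<lambda>x. 1 - g x) \<in> nonneg_polys d K"
    "\<forall>i\<in>{1..s}. p i \<in> K \<and> w i > 0 \<and> g (p i) = 1"
    "\<forall>\<alpha>. mdeg \<alpha> = d \<longrightarrow> has_bochner_integral lborel (\<lambda>x. monomial \<alpha> x * exp (- g x))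
       (\<Sum>i=1..s. w i * monomial \<alpha> (p i))"
  then show "unique_optimal_solution d K g"
    using assms by (intro unique_optimal_solution_if_representation[where p = p and w = w and s = s])
      (auto simp: feasible_def)
qed

end
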